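(* Let $n\ge2$, $p\in\{2,\dots,n\}$, $c,d\in\mathbb{R}$, let $M,K$ be symmetric positive definite $n\times n$ real matrices, and let $\omega_k>0$, $\phi_k\in\mathbb{R}^n$ $(k=1,\dots,n)$ satisfy $K\phi_k=\omega_k^2M\phi_k$ and $\phi_k^TM\phi_l=\delta_{kl}$. Assume that, for each $k\ne1$, $\omega_k$ and $\omega_1$ are $\mathbb{Z}$-independent. For small $\epsilon>0$ let $(y_1,\dots,y_n)$ be the solution of $$\ddot y_k+\omega_k^2y_k+\delta_p\phi_k\left[c\Bigl(\sum_{i=1}^ny_i\,\delta_p\phi_i\Bigr)^2+\frac{d}{\epsilon}\Bigl(\sum_{i=1}^ny_i\,\delta_p\phi_i\Bigr)^3\right]=0,\qquad k=1,\dots,n,$$ with initial data $$y_1(0)=\epsilon a_{1,0},\quad\dot y_1(0)=0,\quad y_k(0)=O(\epsilon^2),\quad\dot y_k(0)=0\quad(k\neq1),$$ where $a_{1,0}\in\mathbb{R}$ is fixed. Then there exists $\gamma>0$ such that, for all sufficiently small $\epsilon>0$ and all $0\le t\le t_\epsilon=\frac{\gamma}{\epsilon}$, $$y_1(t)=\epsilon a_{1,0}\cos(\nu_\epsilon t)+\epsilon^2r_1(\epsilon,t),\qquad\nu_\epsilon=\omega_1+3\epsilon\frac{d\,a_{1,0}^2}{8\omega_1}(\phi_{1,p}-\phi_{1,p-1})^4,$$ $$y_k(t)=\epsilon^2r_k(\epsilon,t),\qquad k\neq1,$$ with $r_k(\epsilon,\cdot)$ uniformly bounded in $C^2(0,t_\epsilon)$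 for $k=1,\dots,n$.
   Context: $\phi_{k,j}$ is the $j$-th component of $\phi_k$ and $\delta_p\phi_k=\phi_{k,p}-\phi_{k,p-1}$. $\mathbb{Z}$-independence of $\omega_k$ and $\omega_1$ means that $m\omega_k+q\omega_1=0$ with $m,q\in\mathbb{Z}$ forces $m=q=0$. The system is the equation $M\ddot u+Ku+\Phi(u,\epsilon)=0$ written in the basis of generalized eigenvectors, $u=\sum_ky_k\phi_k$, where all components of $\Phi$ vanish except $\Phi_p(u,\epsilon)=c(u_p-u_{p-1})^2+\frac{d}{\epsilon}(u_p-u_{p-1})^3$ and $\Phi_{p-1}=-\Phi_p$. "Uniformly bounded in $C^2(0,t_\epsilon)$" means that $|r_k|,|\partial_tr_k|,|\partial_t^2r_k|$ are bounded on $(0,t_\epsilon)$ by a constant independent of $\epsilon$. *)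

theory Defs
  imports
    "HOL-Analysis.Analysis"
    "HOL-Library.Landau_Symbols"
    "Jordan_Normal_Form.Matrix"
begin

definition sym_pos_def :: "nat \<Rightarrow> real mat \<Rightarrow> bool" where
  "sym_pos_def n A \<longleftrightarrow>
     A \<in> carrier_mat n n \<and> transpose_mat A = A \<and>
     (\<forall>x \<in> carrier_vec n. x \<noteq> 0\<^sub>v n \<longrightarrow> scalar_prod x (A *\<^sub>v x) > 0)"

text \<open>Modes are numbered 1, ..., n, and \<open>p\<close> is a component number in 2, ..., n.
  Components of a \<^typ>\<open>real vec\<close> are indexed from 0, so component \<open>j\<close> in the numbering from 1
  is \<open>vec_index v (j - 1)\<close>.\<close>

definition component :: "real vec \<Rightarrow> nat \<Rightarrow> real" where
  "component v j = vec_index v (j - 1)"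

definition delta :: "nat \<Rightarrow> real vec \<Rightarrow> real" where
  "delta p v = component v p - component v (p - 1)"

definition generalized_modes ::
  "nat \<Rightarrow> real mat \<Rightarrow> real mat \<Rightarrow> (nat \<Rightarrow> real) \<Rightarrow> (nat \<Rightarrow> real vec) \<Rightarrow> bool" where
  "generalized_modes n M K \<omega> \<phi> \<longleftrightarrow>
     (\<forall>k\<in>{1..n}. \<omega> k > 0 \<and> \<phi> k \<in> carrier_vec n \<and>
        K *\<^sub>v \<phi> k = (\<omega> k)\<^sup>2 \<cdot>\<^sub>v (M *\<^sub>v \<phi> k)) \<and>
     (\<forall>k\<in>{1..n}. \<forall>l\<in>{1..n}. scalar_prod (\<phi> k) (M *\<^sub>v \<phi> l) = (if k = l then 1 else 0))"

definition Z_independent :: "real \<Rightarrow> real \<Rightarrow> bool" where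
  "Z_independent a b \<longleftrightarrow>
     (\<forall>m q :: int. of_int m * a + of_int q * b = 0 \<longrightarrow> m = 0 \<and> q = 0)"

text \<open>\<open>y k t\<close> is the \<open>k\<close>-th modal coordinate at time \<open>t\<close>. The predicate says that \<open>y\<close> is a classical
  solution on the whole closed interval from 0 to \<open>T\<close> (one-sided derivatives at the
  end points) with \<open>y k 0 = y0 k\<close> and vanishing initial velocities.\<close>

definition modal_solution ::
  "nat \<Rightarrow> nat \<Rightarrow> real \<Rightarrow> real \<Rightarrow> (nat \<Rightarrow> real) \<Rightarrow> (nat \<Rightarrow> real vec) \<Rightarrow> real \<Rightarrow>
   (nat \<Rightarrow> real) \<Rightarrow> real \<Rightarrow> (nat \<Rightarrow> real \<Rightarrow> real) \<Rightarrow> bool" where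
  "modal_solution n p c d \<omega> \<phi> \<epsilon> y0 T y \<longleftrightarrow>
     (\<exists>y' y''. \<forall>k\<in>{1..n}.
        y k 0 = y0 k \<and> y' k 0 = 0 \<and>
        (\<forall>t\<in>{0..T}.
           (y k has_real_derivative y' k t) (at t within {0..T}) \<and>
           (y' k has_real_derivative y'' k t) (at t within {0..T}) \<and>
           y'' k t + (\<omega> k)\<^sup>2 * y k t +
             delta p (\<phi> k) *
               (c * (\<Sum>i=1..n. y i t * delta p (\<phi> i))\<^sup>2 +
                d / \<epsilon> * (\<Sum>i=1..n. y i t * delta p (\<phi> i)) ^ 3) = 0))"

definition C2_bounded_by :: "real \<Rightarrow> real \<Rightarrow> (real \<Rightarrow> real) \<Rightarrow> bool" where
  "C2_bounded_by C T r \<longleftrightarrow>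
     (\<exists>r' r''. continuous_on {0<..<T} r'' \<and>
        (\<forall>t\<in>{0<..<T}.
           (r has_real_derivative r' t) (at t) \<and>
           (r' has_real_derivative r'' t) (at t) \<and>
           \<bar>r t\<bar> \<le> C \<and> \<bar>r' t\<bar> \<le> C \<and> \<bar>r'' t\<bar> \<le> C))"

end

theory Submission
  imports Defs
begin

text \<open>With \<open>y = \<epsilon> z\<close> the system reads \<open>z\<^sub>k'' + \<omega>\<^sub>k\<^sup>2 z\<^sub>k + \<epsilon> D\<^sub>k (c S\<^sup>2 + d S\<^sup>3) = 0\<close>, coupled only through
  the scalar \<open>S = \<Sum> D\<^sub>i z\<^sub>i\<close>. On an interval of length \<open>\<gamma> / \<epsilon>\<close> a forcing of size \<open>\<epsilon> B\<close> moves a harmonic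
  oscillator by at most \<open>\<gamma> B / \<omega>\<close>. For small \<open>\<gamma>\<close> this makes the Duhamel map for \<open>S\<close> a contraction on
  the whole interval, keeps \<open>S\<close> bounded, and absorbs the feedback of the error into itself.

  The error \<open>u\<^sub>k\<close> is the difference between \<open>z\<^sub>k\<close> and \<open>a cos (\<nu> t)\<close> for \<open>k = 1\<close>, and \<open>z\<^sub>k\<close> otherwise. The
  leading forcing of \<open>u\<^sub>k\<close> has the frequencies \<open>0, \<nu>, 2 \<nu>, 3 \<nu>\<close>. By independence over the integers these
  stay away from \<open>\<omega>\<^sub>k\<close>, except for \<open>\<nu>\<close> when \<open>k = 1\<close>, and that term is cancelled up to \<open>\<epsilon>\<^sup>2\<close> by the
  frequency shift in \<open>\<nu>\<close>. Nonresonant forcing of size \<open>\<epsilon>\<close> contributes \<open>O(\<epsilon>)\<close> uniformly in time, so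
  \<open>sup \<bar>\<Sum> D\<^sub>i u\<^sub>i\<bar> \<le> \<epsilon> E + sup \<bar>\<Sum> D\<^sub>i u\<^sub>i\<bar> / 2\<close>.\<close>

section \<open>Forced oscillators\<close>

text \<open>The mean value theorem evaluates \<open>g'\<close> at an interior point only. The bound
  is therefore asked for on the open interval, which suits forcings that are controlled only up to a
  first exit time.\<close>

lemma increment_bound:
  fixes g g' :: "real \<Rightarrow> real"
  assumes "0 \<le> t"
    and der: "\<And>s. s \<in> {0..t} \<Longrightarrow> (g has_real_derivative g' s) (at s within {0..t})"
    and bnd: "\<And>s. s \<in> {0<..<t} \<Longrightarrow> \<bar>g' s\<bar> \<le> B"
  shows "\<bar>g t - g 0\<bar> \<le> t * B"
proof (cases "t = 0")
  case False
  with \<open>0 \<le> t\<close> have "0 < t" by simp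
  have "continuous_on {0..t} g"
    using der by (rule DERIV_continuous_on)
  moreover have "(g has_derivative (*) (g' s)) (at s)" if "0 < s" "s < t" for s
    using der[of s] that by (simp add: has_field_derivative_def at_within_Icc_at)
  ultimately obtain s where s: "0 < s" "s < t" "g t - g 0 = g' s * (t - 0)"
    using mvt[OF \<open>0 < t\<close>, of g "\<lambda>s. (*) (g' s)"] by metis
  have "\<bar>g' s * t\<bar> \<le> B * t"
    using bnd[of s] s \<open>0 < t\<close> by (simp add: abs_mult)
  then show ?thesis
    using s by (simp add: mult.commute)
qed simp

lemma abs_rotation_le:
  fixes x y :: real
  shows "\<bar>x * cos \<theta> + y * sin \<theta>\<bar> \<le> \<bar>x\<bar> + \<bar>y\<bar>"
proof -
  have "\<bar>x * cos \<theta>\<bar> \<le> \<bar>x\<bar>" "\<bar>y * sin \<theta>\<bar> \<le> \<bar>y\<bar>"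
    by (simp_all add: abs_mult mult_left_le)
  then show ?thesis by linarith
qed

text \<open>Variation of constants by the mean value theorem instead of an integral. For fixed
  \<open>t\<close>, take the free motion through the state at time \<open>s\<close> and read it off
  at time \<open>t\<close>. It varies with \<open>s\<close> only because of \<open>h\<close>, at a
  rate of at most \<open>B / \<omega>\<close>, and its velocity at a rate of at most
  \<open>B\<close>. Comparing \<open>s = 0\<close> with \<open>s = t\<close> gives both
  bounds.\<close>

lemma
  fixes v v' h :: "real \<Rightarrow> real"
  assumes \<omega>: "\<omega> > 0" and t: "0 \<le> t"
    and v: "\<And>s. s \<in> {0..t} \<Longrightarrow> (v has_real_derivative v' s) (at s within {0..t})"
    and v': "\<And>s. s \<in> {0..t} \<Longrightarrow>
      (v' has_real_derivative (h s - \<omega>\<^sup>2 * v s)) (at s within {0..t})"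
    and h: "\<And>s. s \<in> {0<..<t} \<Longrightarrow> \<bar>h s\<bar> \<le> B"
  shows forced_oscillator_bound: "\<bar>v t\<bar> \<le> \<bar>v 0\<bar> + \<bar>v' 0\<bar> / \<omega> + t * B / \<omega>"
    and forced_oscillator_deriv_bound: "\<bar>v' t\<bar> \<le> \<omega> * \<bar>v 0\<bar> + \<bar>v' 0\<bar> + t * B"
proof -
  \<comment> \<open>the free motion that agrees with \<open>v\<close> at time \<open>s\<close>, evaluated at time \<open>t\<close>\<close>
  define g where "g s = v s * cos (\<omega> * (t - s)) + v' s / \<omega> * sin (\<omega> * (t - s))" for s
  have "(g has_real_derivative h s / \<omega> * sin (\<omega> * (t - s))) (at s within {0..t})"
    if "s \<in> {0..t}" for s
    unfolding g_def using v[OF that] v'[OF that] \<omega>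
    by (auto intro!: derivative_eq_intros simp: field_simps power2_eq_square)
  moreover have "\<bar>h s / \<omega> * sin (\<omega> * (t - s))\<bar> \<le> B / \<omega>" if "s \<in> {0<..<t}" for s
  proof -
    have "\<bar>h s / \<omega> * sin (\<omega> * (t - s))\<bar> \<le> \<bar>h s\<bar> / \<omega>"
      using \<omega> by (simp add: abs_mult mult_left_le divide_right_mono)
    also have "\<dots> \<le> B / \<omega>"
      using h[OF that] \<omega> by (simp add: divide_right_mono)
    finally show ?thesis .
  qed
  ultimately have "\<bar>g t - g 0\<bar> \<le> t * (B / \<omega>)"
    by (rule increment_bound[OF t])
  moreover have "g t = v t" by (simp add: g_def)
  moreover have "\<bar>g 0\<bar> \<le> \<bar>v 0\<bar> + \<bar>v' 0\<bar> / \<omega>"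
    using abs_rotation_le[of "v 0" "\<omega> * t" "v' 0 / \<omega>"] \<omega> by (simp add: g_def)
  ultimately show "\<bar>v t\<bar> \<le> \<bar>v 0\<bar> + \<bar>v' 0\<bar> / \<omega> + t * B / \<omega>"
    by simp
  \<comment> \<open>The velocity of the same free motion at time \<open>t\<close>, that is, the
    expression for \<open>g s\<close> differentiated with respect to \<open>t\<close>.\<close>
  define k where "k s = v' s * cos (\<omega> * (t - s)) - \<omega> * v s * sin (\<omega> * (t - s))" for s
  have "(k has_real_derivative h s * cos (\<omega> * (t - s))) (at s within {0..t})"
    if "s \<in> {0..t}" for s
    unfolding k_def using v[OF that] v'[OF that] \<omega>
    by (auto intro!: derivative_eq_intros simp: field_simps power2_eq_square)
  moreover have "\<bar>h s * cos (\<omega> * (t - s))\<bar> \<le> B" if "s \<in> {0<..<t}" for s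
  proof -
    have "\<bar>h s * cos (\<omega> * (t - s))\<bar> \<le> \<bar>h s\<bar>"
      by (simp add: abs_mult mult_left_le)
    with h[OF that] show ?thesis by simp
  qed
  ultimately have "\<bar>k t - k 0\<bar> \<le> t * B"
    by (rule increment_bound[OF t])
  moreover have "k t = v' t" by (simp add: k_def)
  moreover have "\<bar>k 0\<bar> \<le> \<bar>v' 0\<bar> + \<omega> * \<bar>v 0\<bar>"
    using abs_rotation_le[of "v' 0" "\<omega> * t" "- \<omega> * v 0"] \<omega> by (simp add: k_def abs_mult)
  ultimately show "\<bar>v' t\<bar> \<le> \<omega> * \<bar>v 0\<bar> + \<bar>v' 0\<bar> + t * B"
    by simp
qed

text \<open>Duhamel's formula. The addition theorem splits the kernel
  \<open>sin (\<omega> * (t - s))\<close>, so that \<open>t\<close> leaves the integrals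
  \<open>C\<close> and \<open>S\<close> and the fundamental theorem of calculus applies to
  them.\<close>

lemma forced_oscillator_exists:
  fixes h :: "real \<Rightarrow> real"
  assumes \<omega>: "\<omega> > 0" and h: "continuous_on {0..T} h"
  shows "\<exists>v v'. v 0 = x0 \<and> v' 0 = 0 \<and> (\<forall>t\<in>{0..T}.
    (v has_real_derivative v' t) (at t within {0..T}) \<and>
    (v' has_real_derivative (h t - \<omega>\<^sup>2 * v t)) (at t within {0..T}))"
proof -
  define C where "C t = integral {0..t} (\<lambda>s. cos (\<omega> * s) * h s)" for t
  define S where "S t = integral {0..t} (\<lambda>s. sin (\<omega> * s) * h s)" for t
  have C: "(C has_real_derivative cos (\<omega> * t) * h t) (at t within {0..T})"
    and S: "(S has_real_derivative sin (\<omega> * t) * h t) (at t within {0..T})" if "t \<in> {0..T}" for t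
    unfolding C_def S_def using that
    by (auto intro!: integral_has_real_derivative continuous_intros h)
  define v where "v t = x0 * cos (\<omega> * t) + (sin (\<omega> * t) * C t - cos (\<omega> * t) * S t) / \<omega>" for t
  define v' where "v' t = - \<omega> * x0 * sin (\<omega> * t) + cos (\<omega> * t) * C t + sin (\<omega> * t) * S t" for t
  have "v 0 = x0" "v' 0 = 0"
    by (simp_all add: v_def v'_def C_def S_def)
  moreover have "(v has_real_derivative v' t) (at t within {0..T})" if "t \<in> {0..T}" for t
    unfolding v_def v'_def using \<omega> C[OF that] S[OF that]
    by (auto intro!: derivative_eq_intros simp: field_simps)
  moreover have "(v' has_real_derivative (h t - \<omega>\<^sup>2 * v t)) (at t within {0..T})"
    if "t \<in> {0..T}" for t
  proof -
    \<comment> \<open>The two integrals contribute \<open>h t\<close> to the derivative of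
      \<open>v'\<close> in exactly this split form.\<close>
    have "h t = h t * (sin (\<omega> * t))\<^sup>2 + h t * (cos (\<omega> * t))\<^sup>2"
      by (simp flip: distrib_left)
    then show ?thesis
      unfolding v_def v'_def using \<omega> C[OF that] S[OF that]
      by (auto intro!: derivative_eq_intros simp: field_simps power2_eq_square)
  qed
  ultimately show ?thesis by blast
qed

section \<open>Oscillators coupled through a scalar\<close>

text \<open>Velocities are an explicit argument because the error estimates speak about them. The
  force \<open>F\<close> is a parameter, so that the same notion covers the polynomial force and its
  truncation, with the factor \<epsilon> absorbed into \<open>F\<close>.\<close>

definition coupled_modes ::
  "'k set \<Rightarrow> ('k \<Rightarrow> real) \<Rightarrow> ('k \<Rightarrow> real) \<Rightarrow> (real \<Rightarrow> real) \<Rightarrow> real \<Rightarrow>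
   ('k \<Rightarrow> real \<Rightarrow> real) \<Rightarrow> ('k \<Rightarrow> real \<Rightarrow> real) \<Rightarrow> bool" where
  "coupled_modes I \<omega> D F T z z' \<longleftrightarrow>
     (\<forall>k\<in>I. z' k 0 = 0 \<and> (\<forall>t\<in>{0..T}.
        (z k has_real_derivative z' k t) (at t within {0..T}) \<and>
        (z' k has_real_derivative (- D k * F (\<Sum>i\<in>I. D i * z i t) - (\<omega> k)\<^sup>2 * z k t))
          (at t within {0..T})))"

lemma coupled_modesD:
  assumes "coupled_modes I \<omega> D F T z z'" "k \<in> I"
  shows "z' k 0 = 0"
    and "t \<in> {0..T} \<Longrightarrow> (z k has_real_derivative z' k t) (at t within {0..T})"
    and "t \<in> {0..T} \<Longrightarrow> (z' k has_real_derivative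
      (- D k * F (\<Sum>i\<in>I. D i * z i t) - (\<omega> k)\<^sup>2 * z k t)) (at t within {0..T})"
  using assms unfolding coupled_modes_def by blast+

lemma coupled_modes_continuous:
  assumes "coupled_modes I \<omega> D F T z z'"
  shows "continuous_on {0..T} (\<lambda>t. \<Sum>i\<in>I. D i * z i t)"
  using coupled_modesD(2)[OF assms]
  by (intro continuous_intros) (rule DERIV_continuous_on)

text \<open>Only the scalar coupling function is sought as a fixed point: once it is prescribed,
  every mode is a forced oscillator with a known solution. The oscillator bound makes the resulting
  map a contraction with constant \<open>T * L * W\<close> in the supremum norm, so the solution
  lives on all of \<open>{0..T}\<close> and no continuation argument enters.\<close>

lemma coupled_modes_exist:
  assumes \<omega>: "\<And>k. k \<in> I \<Longrightarrow> \<omega> k > 0" and T: "0 \<le> T" and L0: "0 \<le> L"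
    and lip: "\<And>x y. \<bar>F x - F y\<bar> \<le> L * \<bar>x - y\<bar>"
    and small: "T * L * (\<Sum>k\<in>I. (D k)\<^sup>2 / \<omega> k) < 1"
  shows "\<exists>z z'. coupled_modes I \<omega> D F T z z' \<and> (\<forall>k\<in>I. z k 0 = zi k)"
proof -
  have Fcont: "continuous_on UNIV F"
  proof (rule continuous_onI)
    fix x e :: real assume "0 < e"
    \<comment> \<open>\<open>L + 1\<close> in place of \<open>L\<close> keeps the divisor positive
      when \<open>L = 0\<close>.\<close>
    have "\<bar>F y - F x\<bar> < e" if "\<bar>y - x\<bar> < e / (L + 1)" for y
    proof -
      have "\<bar>F y - F x\<bar> \<le> (L + 1) * \<bar>y - x\<bar>"
        using lip[of y x] by (simp add: algebra_simps)
      also have "\<dots> < e"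
        using that L0 by (simp add: field_simps)
      finally show ?thesis .
    qed
    then show "\<exists>d>0. \<forall>y\<in>UNIV. dist y x < d \<longrightarrow> dist (F y) (F x) \<le> e"
      using \<open>0 < e\<close> L0 by (intro exI[of _ "e / (L + 1)"]) (auto simp: dist_real_def less_imp_le)
  qed
  define h where "h k S t = - D k * F (apply_bcontfun S t)" for k and S :: "real \<Rightarrow>\<^sub>C real" and t
  have hcont: "continuous_on A (h k S)" for A k S
    unfolding h_def
    by (intro continuous_intros continuous_on_compose2[OF Fcont]) auto
  have "\<forall>k\<in>I. \<forall>S. \<exists>v v'. v 0 = zi k \<and> v' 0 = 0 \<and> (\<forall>t\<in>{0..T}.
    (v has_real_derivative v' t) (at t within {0..T}) \<and>
    (v' has_real_derivative (h k S t - (\<omega> k)\<^sup>2 * v t)) (at t within {0..T}))"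
    using forced_oscillator_exists[OF \<omega> hcont] by blast
  then obtain V V' where
    V0: "\<And>k S. k \<in> I \<Longrightarrow> V k S 0 = zi k" and
    V'0: "\<And>k S. k \<in> I \<Longrightarrow> V' k S 0 = 0" and
    V: "\<And>k S t. k \<in> I \<Longrightarrow> t \<in> {0..T} \<Longrightarrow>
      (V k S has_real_derivative V' k S t) (at t within {0..T})" and
    V': "\<And>k S t. k \<in> I \<Longrightarrow> t \<in> {0..T} \<Longrightarrow>
      (V' k S has_real_derivative (h k S t - (\<omega> k)\<^sup>2 * V k S t)) (at t within {0..T})"
    by metis
  \<comment> \<open>Clamping time to \<open>{0..T}\<close> extends a function from this interval to
    a bounded continuous function on the line. Such functions form the complete space in which
    Banach's theorem is applied.\<close>
  define cl where "cl t = max 0 (min T t)" for t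
  have cl: "cl t \<in> {0..T}" for t
    using T by (simp add: cl_def)
  define \<Phi> where "\<Phi> S t = (\<Sum>k\<in>I. D k * V k S t)" for S t
  define P where "P S = Bcontfun (\<lambda>t. \<Phi> S (cl t))" for S
  have P: "apply_bcontfun (P S) t = \<Phi> S (cl t)" for S t
  proof -
    have c: "continuous_on {0..T} (\<Phi> S)"
      unfolding \<Phi>_def using V by (intro continuous_intros) (rule DERIV_continuous_on)
    have "continuous_on UNIV (\<lambda>t. \<Phi> S (cl t))"
      by (rule continuous_on_compose2[OF c]) (use cl in \<open>auto simp: cl_def intro!: continuous_intros\<close>)
    moreover have "bounded (range (\<lambda>t. \<Phi> S (cl t)))"
      using compact_imp_bounded[OF compact_continuous_image[OF c compact_Icc]]
      by (rule bounded_subset) (use cl in auto)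
    ultimately show ?thesis
      by (simp add: P_def bcontfun_def Bcontfun_inverse)
  qed
  define W where "W = (\<Sum>k\<in>I. (D k)\<^sup>2 / \<omega> k)"
  have "0 \<le> W"
    unfolding W_def using \<omega> by (intro sum_nonneg) (simp add: less_imp_le)
  have contr: "dist (P S1) (P S2) \<le> (T * L * W) * dist S1 S2" for S1 S2
  proof (rule dist_bound)
    fix t
    define d where "d = dist S1 S2"
    have d: "\<bar>apply_bcontfun S1 s - apply_bcontfun S2 s\<bar> \<le> d" for s
      using dist_bounded[of S1 s S2] by (simp add: d_def dist_real_def)
    have "0 \<le> d" by (simp add: d_def)
    define \<tau> where "\<tau> = cl t"
    have \<tau>: "0 \<le> \<tau>" "\<tau> \<le> T" using cl[of t] by (auto simp: \<tau>_def)
    \<comment> \<open>Both motions start from the same state, so their difference is an oscillator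
      at rest, driven only by the difference of the forcings.\<close>
    have 1: "\<bar>V k S1 \<tau> - V k S2 \<tau>\<bar> \<le> \<tau> * (\<bar>D k\<bar> * (L * d)) / \<omega> k" if k: "k \<in> I" for k
    proof -
      let ?v = "\<lambda>s. V k S1 s - V k S2 s" and ?v' = "\<lambda>s. V' k S1 s - V' k S2 s"
      have "(?v has_real_derivative ?v' s) (at s within {0..\<tau>})" if "s \<in> {0..\<tau>}" for s
      proof -
        have s: "s \<in> {0..T}" using that \<tau> by auto
        show ?thesis
          using DERIV_diff[OF V[OF k s, of S1] V[OF k s, of S2]]
          by (rule has_field_derivative_subset) (use \<tau> in auto)
      qed
      moreover have "(?v' has_real_derivative (h k S1 s - h k S2 s - (\<omega> k)\<^sup>2 * ?v s))
          (at s within {0..\<tau>})" if "s \<in> {0..\<tau>}" for s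
      proof -
        have s: "s \<in> {0..T}" using that \<tau> by auto
        have "(?v' has_real_derivative (h k S1 s - h k S2 s - (\<omega> k)\<^sup>2 * ?v s)) (at s within {0..T})"
          using DERIV_diff[OF V'[OF k s, of S1] V'[OF k s, of S2]]
          by (simp add: algebra_simps)
        then show ?thesis
          by (rule has_field_derivative_subset) (use \<tau> in auto)
      qed
      moreover have "\<bar>h k S1 s - h k S2 s\<bar> \<le> \<bar>D k\<bar> * (L * d)" for s
      proof -
        have "\<bar>h k S1 s - h k S2 s\<bar>
            = \<bar>D k\<bar> * \<bar>F (apply_bcontfun S1 s) - F (apply_bcontfun S2 s)\<bar>"
          unfolding h_def abs_mult[symmetric] by (subst abs_minus_commute) (simp add: algebra_simps)
        also have "\<bar>F (apply_bcontfun S1 s) - F (apply_bcontfun S2 s)\<bar> \<le> L * d"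
          using lip d L0 by (rule order_trans[OF _ mult_left_mono])
        finally show ?thesis by (simp add: mult_left_mono)
      qed
      ultimately have "\<bar>?v \<tau>\<bar> \<le> \<bar>?v 0\<bar> + \<bar>?v' 0\<bar> / \<omega> k + \<tau> * (\<bar>D k\<bar> * (L * d)) / \<omega> k"
        by (rule forced_oscillator_bound[OF \<omega>[OF k] \<tau>(1)])
      then show ?thesis by (simp add: V0[OF k] V'0[OF k])
    qed
    have "\<bar>\<Phi> S1 \<tau> - \<Phi> S2 \<tau>\<bar> = \<bar>\<Sum>k\<in>I. D k * (V k S1 \<tau> - V k S2 \<tau>)\<bar>"
      by (simp add: \<Phi>_def sum_subtractf right_diff_distrib)
    also have "\<dots> \<le> (\<Sum>k\<in>I. \<tau> * L * d * ((D k)\<^sup>2 / \<omega> k))"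
    proof (rule order_trans[OF sum_abs sum_mono])
      fix k assume k: "k \<in> I"
      have "\<bar>D k * (V k S1 \<tau> - V k S2 \<tau>)\<bar> \<le> \<bar>D k\<bar> * (\<tau> * (\<bar>D k\<bar> * (L * d)) / \<omega> k)"
        unfolding abs_mult using 1[OF k] by (rule mult_left_mono) simp
      also have "\<dots> = \<tau> * L * d * ((D k)\<^sup>2 / \<omega> k)"
        using abs_mult_self_eq[of "D k"] by (simp add: power2_eq_square mult.commute mult.left_commute)
      finally show "\<bar>D k * (V k S1 \<tau> - V k S2 \<tau>)\<bar> \<le> \<tau> * L * d * ((D k)\<^sup>2 / \<omega> k)" .
    qed
    also have "\<dots> = \<tau> * (L * d * W)"
      by (simp add: W_def sum_distrib_left mult.assoc)
    also have "\<dots> \<le> T * (L * d * W)"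
      using \<tau> L0 \<open>0 \<le> d\<close> \<open>0 \<le> W\<close> by (intro mult_right_mono) auto
    finally show "dist (apply_bcontfun (P S1) t) (apply_bcontfun (P S2) t) \<le> T * L * W * dist S1 S2"
      by (simp add: P dist_real_def \<tau>_def d_def mult_ac)
  qed
  have "\<exists>!S. P S = S"
    using contr T L0 \<open>0 \<le> W\<close> small
    by (intro banach_fix_type[of "T * L * W"]) (auto simp: W_def)
  then obtain S where S: "P S = S" by blast
  \<comment> \<open>On \<open>{0..T}\<close> clamping does nothing, so the fixed point is the
    coupling scalar of the modes that it drives.\<close>
  have "apply_bcontfun S t = (\<Sum>k\<in>I. D k * V k S t)" if "t \<in> {0..T}" for t
    using P[of S t] that by (simp add: S cl_def \<Phi>_def)
  then have "coupled_modes I \<omega> D F T (\<lambda>k. V k S) (\<lambda>k. V' k S)"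
    unfolding coupled_modes_def using V'0 V V'[of _ _ S] by (simp add: h_def)
  then show ?thesis using V0 by blast
qed

text \<open>A bootstrap: as long as the coupling scalar stays within \<open>R\<close>, each forcing
  is at most \<open>\<bar>D k\<bar> * B\<close>. The oscillator bound then keeps the scalar strictly
  below \<open>R\<close>, which rules out a first time of reaching \<open>R\<close>.\<close>

lemma coupled_modes_bounded:
  assumes \<omega>: "\<And>k. k \<in> I \<Longrightarrow> \<omega> k > 0" and B: "0 \<le> B"
    and z: "coupled_modes I \<omega> D F T z z'"
    and F: "\<And>x. \<bar>x\<bar> \<le> R \<Longrightarrow> \<bar>F x\<bar> \<le> B"
    and small: "(\<Sum>k\<in>I. \<bar>D k\<bar> * \<bar>z k 0\<bar>) + T * B * (\<Sum>k\<in>I. (D k)\<^sup>2 / \<omega> k) < R"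
    and t: "t \<in> {0..T}"
  shows "\<bar>\<Sum>k\<in>I. D k * z k t\<bar> \<le> R"
proof (rule ccontr)
  define S where "S t = (\<Sum>k\<in>I. D k * z k t)" for t
  have S: "continuous_on {0..T} S"
    unfolding S_def using z by (rule coupled_modes_continuous)
  define E where "E = {0..T} \<inter> {t. R \<le> \<bar>S t\<bar>}"
  have "closed E"
    unfolding E_def Int_def mem_Collect_eq
    using continuous_closed_preimage[OF continuous_on_rabs[OF S] closed_atLeastAtMost closed_atLeast, of R]
    by (simp add: vimage_def Int_def)
  then have "compact E"
    by (simp add: E_def compact_eq_bounded_closed bounded_Int)
  assume "\<not> ?thesis"
  with t have "E \<noteq> {}" by (auto simp: E_def S_def)
  \<comment> \<open>the first time at which \<open>\<bar>S\<bar>\<close> reaches \<open>R\<close>\<close>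
  with \<open>compact E\<close> obtain \<tau> where \<tau>: "\<tau> \<in> E" and min: "\<And>s. s \<in> E \<Longrightarrow> \<tau> \<le> s"
    using compact_attains_inf by metis
  have \<tau>T: "0 \<le> \<tau>" "\<tau> \<le> T" using \<tau> by (auto simp: E_def)
  have before: "\<bar>S s\<bar> \<le> R" if "s \<in> {0<..<\<tau>}" for s
    using min[of s] that \<tau>T by (force simp: E_def)
  define W where "W = (\<Sum>k\<in>I. (D k)\<^sup>2 / \<omega> k)"
  have "0 \<le> W"
    unfolding W_def using \<omega> by (intro sum_nonneg) (simp add: less_imp_le)
  have "\<bar>D k * z k \<tau>\<bar> \<le> \<bar>D k\<bar> * \<bar>z k 0\<bar> + \<tau> * B * ((D k)\<^sup>2 / \<omega> k)" if k: "k \<in> I" for k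
  proof -
    have "\<bar>z k \<tau>\<bar> \<le> \<bar>z k 0\<bar> + \<bar>z' k 0\<bar> / \<omega> k + \<tau> * (\<bar>D k\<bar> * B) / \<omega> k"
    proof (rule forced_oscillator_bound[OF \<omega>[OF k] \<tau>T(1)])
      fix s assume s: "s \<in> {0..\<tau>}"
      with \<tau>T have sT: "s \<in> {0..T}" by auto
      show "(z k has_real_derivative z' k s) (at s within {0..\<tau>})"
        using coupled_modesD(2)[OF z k sT] by (rule has_field_derivative_subset) (use \<tau>T in auto)
      show "(z' k has_real_derivative (- D k * F (S s) - (\<omega> k)\<^sup>2 * z k s)) (at s within {0..\<tau>})"
        using coupled_modesD(3)[OF z k sT] unfolding S_def
        by (rule has_field_derivative_subset) (use \<tau>T in auto)
    next
      fix s assume "s \<in> {0<..<\<tau>}"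
      then show "\<bar>- D k * F (S s)\<bar> \<le> \<bar>D k\<bar> * B"
        using F[OF before] by (simp add: abs_mult mult_left_mono)
    qed
    then have "\<bar>D k\<bar> * \<bar>z k \<tau>\<bar> \<le> \<bar>D k\<bar> * (\<bar>z k 0\<bar> + \<tau> * (\<bar>D k\<bar> * B) / \<omega> k)"
      by (intro mult_left_mono) (simp_all add: coupled_modesD(1)[OF z k])
    then show ?thesis
      by (simp add: abs_mult distrib_left power2_eq_square mult_ac)
  qed
  then have "\<bar>S \<tau>\<bar> \<le> (\<Sum>k\<in>I. \<bar>D k\<bar> * \<bar>z k 0\<bar> + \<tau> * B * ((D k)\<^sup>2 / \<omega> k))"
    unfolding S_def by (intro order_trans[OF sum_abs sum_mono])
  also have "\<dots> = (\<Sum>k\<in>I. \<bar>D k\<bar> * \<bar>z k 0\<bar>) + \<tau> * B * W"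
    by (simp add: W_def sum.distrib sum_distrib_left)
  also have "\<dots> \<le> (\<Sum>k\<in>I. \<bar>D k\<bar> * \<bar>z k 0\<bar>) + T * B * W"
    using \<tau>T B \<open>0 \<le> W\<close> by (simp add: mult_right_mono)
  also have "\<dots> < R"
    using small by (simp add: W_def)
  finally show False
    using \<tau> by (simp add: E_def)
qed

section \<open>Nonresonant forcing\<close>

text \<open>Away from resonance the trigonometric forcing has a periodic response \<open>P\<close>
  whose size does not grow with time. Subtracting it leaves an oscillator driven by \<open>g\<close>
  alone, and only \<open>g\<close> picks up the factor \<open>t\<close>.\<close>

lemma nonresonant_bound:
  fixes u u' g :: "real \<Rightarrow> real" and \<beta> :: "nat \<Rightarrow> real"
  assumes \<omega>: "\<omega> > 0" and t: "0 \<le> t" and \<eta>: "0 < \<eta>"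
    and gap: "\<And>m. m \<in> N \<Longrightarrow> \<eta> \<le> \<bar>\<omega>\<^sup>2 - (real m * \<mu>)\<^sup>2\<bar>"
    and u0: "u' 0 = 0"
    and u: "\<And>s. s \<in> {0..t} \<Longrightarrow> (u has_real_derivative u' s) (at s within {0..t})"
    and u': "\<And>s. s \<in> {0..t} \<Longrightarrow> (u' has_real_derivative
      ((\<Sum>m\<in>N. \<beta> m * cos (real m * \<mu> * s)) + g s - \<omega>\<^sup>2 * u s)) (at s within {0..t})"
    and g: "\<And>s. s \<in> {0<..<t} \<Longrightarrow> \<bar>g s\<bar> \<le> G"
  shows "\<bar>u t\<bar> \<le> \<bar>u 0\<bar> + 2 * (\<Sum>m\<in>N. \<bar>\<beta> m\<bar>) / \<eta> + t * G / \<omega>"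
    and "\<bar>u' t\<bar> \<le> \<omega> * \<bar>u 0\<bar> + \<omega> * (\<Sum>m\<in>N. \<bar>\<beta> m\<bar>) / \<eta>
      + (\<Sum>m\<in>N. \<bar>\<beta> m\<bar> * (real m * \<bar>\<mu>\<bar>)) / \<eta> + t * G"
proof -
  \<comment> \<open>The amplitude of the stationary response to the \<open>m\<close>-th harmonic;
    \<open>gap\<close> bounds its denominator from below.\<close>
  define q where "q m = \<beta> m / (\<omega>\<^sup>2 - (real m * \<mu>)\<^sup>2)" for m
  have q: "\<bar>q m\<bar> \<le> \<bar>\<beta> m\<bar> / \<eta>" "q m * (\<omega>\<^sup>2 - (real m * \<mu>)\<^sup>2) = \<beta> m" if "m \<in> N" for m
    using gap[OF that] \<eta> by (auto simp: q_def intro!: divide_left_mono)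
  define P where "P s = (\<Sum>m\<in>N. q m * cos (real m * \<mu> * s))" for s
  define P' where "P' s = - (\<Sum>m\<in>N. q m * (real m * \<mu>) * sin (real m * \<mu> * s))" for s
  have P_bound: "\<bar>P s\<bar> \<le> (\<Sum>m\<in>N. \<bar>\<beta> m\<bar>) / \<eta>" for s
  proof -
    have "\<bar>P s\<bar> \<le> (\<Sum>m\<in>N. \<bar>\<beta> m\<bar> / \<eta>)"
      unfolding P_def
    proof (rule order_trans[OF sum_abs sum_mono])
      fix m assume m: "m \<in> N"
      have "\<bar>q m * cos (real m * \<mu> * s)\<bar> \<le> \<bar>q m\<bar>"
        by (simp add: abs_mult mult_left_le)
      with q(1)[OF m] show "\<bar>q m * cos (real m * \<mu> * s)\<bar> \<le> \<bar>\<beta> m\<bar> / \<eta>" by simp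
    qed
    then show ?thesis by (simp add: sum_divide_distrib)
  qed
  have P'_bound: "\<bar>P' s\<bar> \<le> (\<Sum>m\<in>N. \<bar>\<beta> m\<bar> * (real m * \<bar>\<mu>\<bar>)) / \<eta>" for s
  proof -
    have "\<bar>P' s\<bar> \<le> (\<Sum>m\<in>N. \<bar>\<beta> m\<bar> * (real m * \<bar>\<mu>\<bar>) / \<eta>)"
      unfolding P'_def abs_minus_cancel
    proof (rule order_trans[OF sum_abs sum_mono])
      fix m assume m: "m \<in> N"
      have "\<bar>q m * (real m * \<mu>) * sin (real m * \<mu> * s)\<bar> \<le> \<bar>q m\<bar> * (real m * \<bar>\<mu>\<bar>)"
        by (simp add: abs_mult mult_left_le)
      also have "\<dots> \<le> \<bar>\<beta> m\<bar> / \<eta> * (real m * \<bar>\<mu>\<bar>)"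
        using q(1)[OF m] by (rule mult_right_mono) simp
      finally show "\<bar>q m * (real m * \<mu>) * sin (real m * \<mu> * s)\<bar> \<le> \<bar>\<beta> m\<bar> * (real m * \<bar>\<mu>\<bar>) / \<eta>"
        by simp
    qed
    then show ?thesis by (simp add: sum_divide_distrib)
  qed
  define v where "v s = u s - P s" for s
  define v' where "v' s = u' s - P' s" for s
  have v: "(v has_real_derivative v' s) (at s within {0..t})" if "s \<in> {0..t}" for s
    unfolding v_def v'_def P_def P'_def using u[OF that]
    by (auto intro!: derivative_eq_intros simp: sum_negf mult_ac)
  have v': "(v' has_real_derivative (g s - \<omega>\<^sup>2 * v s)) (at s within {0..t})" if "s \<in> {0..t}" for s
  proof -
    have "(P' has_real_derivative - (\<Sum>m\<in>N. q m * (real m * \<mu>)\<^sup>2 * cos (real m * \<mu> * s)))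
        (at s within {0..t})"
      unfolding P'_def
      by (auto intro!: derivative_eq_intros simp: power2_eq_square mult_ac)
    \<comment> \<open>Term by term, \<open>P'' + \<omega>\<^sup>2 P\<close> reproduces the
      trigonometric forcing, so it drops out of the equation for \<open>v\<close>.\<close>
    moreover have "(\<Sum>m\<in>N. \<beta> m * cos (real m * \<mu> * s))
        = \<omega>\<^sup>2 * P s - (\<Sum>m\<in>N. q m * (real m * \<mu>)\<^sup>2 * cos (real m * \<mu> * s))"
      unfolding P_def sum_distrib_left sum_subtractf[symmetric]
      by (rule sum.cong) (simp_all add: algebra_simps flip: q(2))
    ultimately show ?thesis
      unfolding v'_def v_def using u'[OF that]
      by (auto intro!: derivative_eq_intros simp: algebra_simps)
  qed
  \<comment> \<open>\<open>P\<close> enters the final bound twice, at time 0 and at time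
    \<open>t\<close>, hence the factor 2. Its derivative consists of sines, so it leaves the initial
    velocity unchanged.\<close>
  have v0: "\<bar>v 0\<bar> \<le> \<bar>u 0\<bar> + (\<Sum>m\<in>N. \<bar>\<beta> m\<bar>) / \<eta>" "v' 0 = 0"
    using P_bound[of 0] u0 by (simp_all add: v_def v'_def P'_def)
  have "\<bar>v t\<bar> \<le> \<bar>v 0\<bar> + \<bar>v' 0\<bar> / \<omega> + t * G / \<omega>"
    using \<omega> t v v' g by (rule forced_oscillator_bound)
  then show "\<bar>u t\<bar> \<le> \<bar>u 0\<bar> + 2 * (\<Sum>m\<in>N. \<bar>\<beta> m\<bar>) / \<eta> + t * G / \<omega>"
    using v0 P_bound[of t] by (simp add: v_def)
  have "\<bar>v' t\<bar> \<le> \<omega> * \<bar>v 0\<bar> + \<bar>v' 0\<bar> + t * G"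
    using \<omega> t v v' g by (rule forced_oscillator_deriv_bound)
  moreover have "\<omega> * \<bar>v 0\<bar> \<le> \<omega> * \<bar>u 0\<bar> + \<omega> * (\<Sum>m\<in>N. \<bar>\<beta> m\<bar>) / \<eta>"
    using mult_left_mono[OF v0(1), of \<omega>] \<omega> by (simp add: distrib_left)
  ultimately show "\<bar>u' t\<bar> \<le> \<omega> * \<bar>u 0\<bar> + \<omega> * (\<Sum>m\<in>N. \<bar>\<beta> m\<bar>) / \<eta>
      + (\<Sum>m\<in>N. \<bar>\<beta> m\<bar> * (real m * \<bar>\<mu>\<bar>)) / \<eta> + t * G"
    using v0(2) P'_bound[of t] v'_def[of t] by linarith
qed

text \<open>Each \<open>\<bar>f x\<bar>\<close> eventually exceeds half of its positive limit, and
  the minimum over finitely many \<open>x\<close> is still positive. This carries the nonresonance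
  at \<epsilon> = 0 over to all small \<epsilon> with a single gap.\<close>

lemma eventually_bounded_away:
  fixes f :: "'x \<Rightarrow> 'e \<Rightarrow> real"
  assumes "finite X" and "\<And>x. x \<in> X \<Longrightarrow> (f x \<longlongrightarrow> l x) F" and "\<And>x. x \<in> X \<Longrightarrow> l x \<noteq> 0"
  shows "\<exists>\<eta>>0. \<forall>\<^sub>F e in F. \<forall>x\<in>X. \<eta> \<le> \<bar>f x e\<bar>"
  using assms
proof (induction X rule: finite_induct)
  case empty
  show ?case by (intro exI[of _ 1]) simp
next
  case (insert x X)
  then obtain \<eta> where \<eta>: "\<eta> > 0" "\<forall>\<^sub>F e in F. \<forall>x\<in>X. \<eta> \<le> \<bar>f x e\<bar>" by auto
  have "((\<lambda>e. \<bar>f x e\<bar>) \<longlongrightarrow> \<bar>l x\<bar>) F"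
    using insert.prems(1) by (intro tendsto_rabs) simp
  moreover have "\<bar>l x\<bar> / 2 < \<bar>l x\<bar>"
    using insert.prems(2)[of x] by simp
  ultimately have "\<forall>\<^sub>F e in F. \<bar>l x\<bar> / 2 < \<bar>f x e\<bar>"
    by (rule order_tendstoD)
  with \<eta>(2) have "\<forall>\<^sub>F e in F. \<forall>y\<in>insert x X. min \<eta> (\<bar>l x\<bar> / 2) \<le> \<bar>f y e\<bar>"
    by eventually_elim auto
  then show ?case
    using \<eta>(1) insert.prems(2)[of x] by (intro exI[of _ "min \<eta> (\<bar>l x\<bar> / 2)"]) auto
qed

section \<open>The weakly nonlinear system\<close>

text \<open>The nonlinearity after the rescaling \<open>y = \<epsilon> z\<close>: the coefficient
  \<open>d / \<epsilon>\<close> puts the quadratic and the cubic term at the same order in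
  \<epsilon>.\<close>

definition force :: "real \<Rightarrow> real \<Rightarrow> real \<Rightarrow> real" where
  "force c d x = c * x\<^sup>2 + d * x ^ 3"

text \<open>Factor \<open>x - y\<close> out of the differences of squares and of cubes; the
  cofactors are at most \<open>2 * R\<close> and \<open>3 * R\<^sup>2\<close> in absolute
  value.\<close>

lemma force_lipschitz:
  assumes "\<bar>x\<bar> \<le> R" "\<bar>y\<bar> \<le> R"
  shows "\<bar>force c d x - force c d y\<bar> \<le> (2 * \<bar>c\<bar> * R + 3 * \<bar>d\<bar> * R\<^sup>2) * \<bar>x - y\<bar>"
proof -
  have R: "0 \<le> R" using assms(1) by linarith
  have "\<bar>x\<^sup>2 + x * y + y\<^sup>2\<bar> \<le> 3 * R\<^sup>2"
  proof -
    have "\<bar>x\<^sup>2\<bar> \<le> R\<^sup>2" "\<bar>y\<^sup>2\<bar> \<le> R\<^sup>2"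
      using assms by (simp_all add: abs_le_square_iff[symmetric])
    moreover have "\<bar>x * y\<bar> \<le> R\<^sup>2"
      unfolding abs_mult power2_eq_square using assms R by (intro mult_mono) auto
    ultimately show ?thesis by linarith
  qed
  then have "\<bar>d\<bar> * \<bar>x\<^sup>2 + x * y + y\<^sup>2\<bar> \<le> \<bar>d\<bar> * (3 * R\<^sup>2)"
    by (rule mult_left_mono) simp
  moreover have "\<bar>c\<bar> * \<bar>x + y\<bar> \<le> \<bar>c\<bar> * (2 * R)"
    using assms by (intro mult_left_mono) auto
  moreover have "\<bar>c * (x + y) + d * (x\<^sup>2 + x * y + y\<^sup>2)\<bar>
      \<le> \<bar>c\<bar> * \<bar>x + y\<bar> + \<bar>d\<bar> * \<bar>x\<^sup>2 + x * y + y\<^sup>2\<bar>"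
    by (rule order_trans[OF abs_triangle_ineq]) (simp add: abs_mult)
  ultimately have "\<bar>c * (x + y) + d * (x\<^sup>2 + x * y + y\<^sup>2)\<bar> \<le> 2 * \<bar>c\<bar> * R + 3 * \<bar>d\<bar> * R\<^sup>2"
    by linarith
  then have "\<bar>c * (x + y) + d * (x\<^sup>2 + x * y + y\<^sup>2)\<bar> * \<bar>x - y\<bar>
      \<le> (2 * \<bar>c\<bar> * R + 3 * \<bar>d\<bar> * R\<^sup>2) * \<bar>x - y\<bar>"
    by (rule mult_right_mono) simp
  moreover have "force c d x - force c d y = (c * (x + y) + d * (x\<^sup>2 + x * y + y\<^sup>2)) * (x - y)"
    by (simp add: force_def algebra_simps power2_eq_square power3_eq_cube)
  ultimately show ?thesis
    by (simp add: abs_mult)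
qed

text \<open>The cosine coefficients of the force along \<open>A * cos \<theta>\<close>, from the
  double and triple angle formulas. They are meant for \<open>m \<le> 3\<close>; the last branch
  serves \<open>m = 0\<close> and \<open>m = 2\<close>, which share the coefficient coming from the
  square.\<close>

definition harmonic :: "real \<Rightarrow> real \<Rightarrow> real \<Rightarrow> nat \<Rightarrow> real" where
  "harmonic c d A m =
     (if m = 1 then 3 / 4 * (d * A ^ 3) else if m = 3 then d * A ^ 3 / 4 else c * A\<^sup>2 / 2)"

lemma force_cos:
  "force c d (A * cos \<theta>) = (\<Sum>m\<le>3. harmonic c d A m * cos (real m * \<theta>))"
proof -
  have "(\<Sum>m\<le>3. harmonic c d A m * cos (real m * \<theta>))
      = c * A\<^sup>2 / 2 + 3 / 4 * (d * A ^ 3) * cos \<theta> + c * A\<^sup>2 / 2 * cos (2 * \<theta>)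
        + d * A ^ 3 / 4 * cos (3 * \<theta>)"
    by (simp add: harmonic_def numeral_3_eq_3)
  then show ?thesis
    unfolding force_def cos_double_cos cos_treble_cos
    by (simp add: power_mult_distrib algebra_simps)
qed

text \<open>\<open>C\<close> is chosen before \<epsilon> and the solution, which makes the bounds
  uniform. Mode \<open>j\<close> is the excited one, and only its own fundamental
  \<open>m = 1\<close> is exempt from the gap condition. The third bound concerns the second
  derivative of the error, with the acceleration of \<open>z\<close> expressed by the
  equation.\<close>

lemma weakly_nonlinear_estimate:
  fixes I :: "'k set" and \<omega> D :: "'k \<Rightarrow> real" and c d a R L \<eta> \<gamma> C0 :: real and j :: 'k
  assumes I: "finite I" and j: "j \<in> I" and \<omega>: "\<And>k. k \<in> I \<Longrightarrow> \<omega> k > 0"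
    and \<eta>: "0 < \<eta>" and L: "0 \<le> L" and \<gamma>: "0 < \<gamma>"
    and lip: "\<And>x y. \<bar>x\<bar> \<le> R \<Longrightarrow> \<bar>y\<bar> \<le> R \<Longrightarrow> \<bar>force c d x - force c d y\<bar> \<le> L * \<bar>x - y\<bar>"
    and aR: "\<bar>D j * a\<bar> \<le> R"
    and small: "\<gamma> * L * (\<Sum>k\<in>I. (D k)\<^sup>2 / \<omega> k) \<le> 1 / 2"
  defines "\<nu> \<equiv> \<lambda>\<epsilon>. \<omega> j + 3 * \<epsilon> * (d * a\<^sup>2 / (8 * \<omega> j)) * D j ^ 4"
    and "amp \<equiv> \<lambda>k. if k = j then a else 0"
  shows "\<exists>C. \<forall>\<epsilon> z z'. 0 < \<epsilon> \<and> \<epsilon> \<le> 1 \<and>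
      coupled_modes I \<omega> D (\<lambda>x. \<epsilon> * force c d x) (\<gamma> / \<epsilon>) z z' \<and>
      (\<forall>t\<in>{0..\<gamma> / \<epsilon>}. \<bar>\<Sum>i\<in>I. D i * z i t\<bar> \<le> R) \<and>
      (\<forall>k\<in>I. \<forall>m\<in>{..3} - (if k = j then {1} else {}). \<eta> \<le> \<bar>(\<omega> k)\<^sup>2 - (real m * \<nu> \<epsilon>)\<^sup>2\<bar>) \<and>
      (\<forall>k\<in>I. \<bar>z k 0 - amp k\<bar> \<le> C0 * \<epsilon>) \<longrightarrow>
      (\<forall>k\<in>I. \<forall>t\<in>{0..\<gamma> / \<epsilon>}.
        \<bar>z k t - amp k * cos (\<nu> \<epsilon> * t)\<bar> \<le> C * \<epsilon> \<and>
        \<bar>z' k t + amp k * \<nu> \<epsilon> * sin (\<nu> \<epsilon> * t)\<bar> \<le> C * \<epsilon> \<and>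
        \<bar>- D k * (\<epsilon> * force c d (\<Sum>i\<in>I. D i * z i t)) - (\<omega> k)\<^sup>2 * z k t
          + amp k * (\<nu> \<epsilon>)\<^sup>2 * cos (\<nu> \<epsilon> * t)\<bar> \<le> C * \<epsilon>)"
proof -

  \<comment> \<open>Constants that do not depend on \<epsilon>\<close>
  define \<kappa> where "\<kappa> = 3 * (d * a\<^sup>2 / (8 * \<omega> j)) * D j ^ 4"
  have \<nu>: "\<nu> \<epsilon> = \<omega> j + \<epsilon> * \<kappa>" for \<epsilon>
    by (simp add: \<nu>_def \<kappa>_def)
  define b where "b = harmonic c d (D j * a)"
  define N where "N k = {..3::nat} - (if k = j then {1} else {})" for k
  have N: "finite (N k)" "N k \<subseteq> {..3}" for k by (auto simp: N_def)
  define W where "W = (\<Sum>k\<in>I. (D k)\<^sup>2 / \<omega> k)"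
  define B where "B = (\<Sum>m\<le>3. \<bar>b m\<bar>)"
  have B: "(\<Sum>m\<in>N k. \<bar>b m\<bar>) \<le> B" for k
    unfolding B_def using N by (intro sum_mono2) auto
  have "0 \<le> B" unfolding B_def by (intro sum_nonneg) simp
  \<comment> \<open>A bound for \<open>\<bar>\<nu> \<epsilon>\<bar>\<close> that is valid for all
    \<epsilon> in (0, 1].\<close>
  define \<nu>1 where "\<nu>1 = \<omega> j + \<bar>\<kappa>\<bar>"
  have "0 \<le> \<nu>1" using \<omega>[OF j] by (simp add: \<nu>1_def)
  \<comment> \<open>If the coupling error is at most \<open>\<epsilon> * E\<close>, then
    \<open>\<epsilon>\<^sup>2 * G E k\<close> bounds the forcing of mode \<open>k\<close> that
    remains beside the nonresonant harmonics.\<close>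
  define G where "G E k = \<bar>D k\<bar> * (L * E) + \<kappa>\<^sup>2 * \<bar>a\<bar>" for E k
  \<comment> \<open>The part of the bound for the error of mode \<open>k\<close>, divided by
    \<epsilon>, that is free of feedback from the coupling error. Absorbing the feedback doubles the
    sum \<open>E\<close>, hence the argument \<open>2 * E\<close> in the constants below.
    \<open>C1\<close>, \<open>C2\<close>, \<open>C3\<close> serve the error and its first two
    derivatives.\<close>
  define A where "A k = C0 + 2 * \<bar>D k\<bar> * B / \<eta> + \<gamma> * (\<kappa>\<^sup>2 * \<bar>a\<bar>) / \<omega> k" for k
  define E where "E = (\<Sum>k\<in>I. \<bar>D k\<bar> * A k)"
  define C1 where "C1 k = C0 + 2 * \<bar>D k\<bar> * B / \<eta> + \<gamma> * G (2 * E) k / \<omega> k" for k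
  define C2 where "C2 k = \<omega> k * C0 + \<omega> k * \<bar>D k\<bar> * B / \<eta>
    + 3 * \<nu>1 * \<bar>D k\<bar> * B / \<eta> + \<gamma> * G (2 * E) k" for k
  define C3 where "C3 k = \<bar>D k\<bar> * (L * R) + \<bar>a\<bar> * (2 * \<omega> j * \<bar>\<kappa>\<bar> + \<kappa>\<^sup>2) + (\<omega> k)\<^sup>2 * C1 k" for k
  define C where "C = (\<Sum>k\<in>I. \<bar>C1 k\<bar> + \<bar>C2 k\<bar> + \<bar>C3 k\<bar>)"
  have C: "C1 k \<le> C" "C2 k \<le> C" "C3 k \<le> C" if "k \<in> I" for k
  proof -
    have "\<bar>C1 k\<bar> + \<bar>C2 k\<bar> + \<bar>C3 k\<bar> \<le> C"
      unfolding C_def using I that by (intro member_le_sum) auto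
    then show "C1 k \<le> C" "C2 k \<le> C" "C3 k \<le> C" by linarith+
  qed
  show ?thesis
  proof (intro exI[of _ C] allI impI, elim conjE)
    fix \<epsilon> z z'
    assume \<epsilon>: "0 < \<epsilon>" "\<epsilon> \<le> 1"
      and z: "coupled_modes I \<omega> D (\<lambda>x. \<epsilon> * force c d x) (\<gamma> / \<epsilon>) z z'"
      and zR: "\<forall>t\<in>{0..\<gamma> / \<epsilon>}. \<bar>\<Sum>i\<in>I. D i * z i t\<bar> \<le> R"
      and "\<forall>k\<in>I. \<forall>m\<in>{..3} - (if k = j then {1} else {}). \<eta> \<le> \<bar>(\<omega> k)\<^sup>2 - (real m * \<nu> \<epsilon>)\<^sup>2\<bar>"
      and init: "\<forall>k\<in>I. \<bar>z k 0 - amp k\<bar> \<le> C0 * \<epsilon>"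
    then have gap: "\<And>k m. k \<in> I \<Longrightarrow> m \<in> N k \<Longrightarrow> \<eta> \<le> \<bar>(\<omega> k)\<^sup>2 - (real m * \<nu> \<epsilon>)\<^sup>2\<bar>"
      unfolding N_def by blast

    \<comment> \<open>The error and its equation of motion\<close>
    define T where "T = \<gamma> / \<epsilon>"
    have T: "0 < T" "T * \<epsilon> = \<gamma>" using \<epsilon> \<gamma> by (simp_all add: T_def)
    define S where "S t = (\<Sum>i\<in>I. D i * z i t)" for t
    define S0 where "S0 t = D j * a * cos (\<nu> \<epsilon> * t)" for t
    have SR: "\<bar>S t\<bar> \<le> R" if "t \<in> {0..T}" for t
      using zR that by (simp add: S_def T_def)
    have S0R: "\<bar>S0 t\<bar> \<le> R" for t
    proof -
      have "\<bar>S0 t\<bar> \<le> \<bar>D j * a\<bar>"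
        unfolding S0_def abs_mult[of "D j * a"] by (intro mult_left_le) auto
      with aR show ?thesis by simp
    qed
    define u where "u k t = z k t - amp k * cos (\<nu> \<epsilon> * t)" for k t
    define u' where "u' k t = z' k t + amp k * \<nu> \<epsilon> * sin (\<nu> \<epsilon> * t)" for k t
    have Su: "S t - S0 t = (\<Sum>k\<in>I. D k * u k t)" for t
    proof -
      have "(\<Sum>k\<in>I. D k * (amp k * cos (\<nu> \<epsilon> * t))) = (\<Sum>k\<in>I. if k = j then S0 t else 0)"
        by (rule sum.cong) (simp_all add: amp_def S0_def)
      then show ?thesis
        using I j by (simp add: u_def S_def right_diff_distrib sum_subtractf)
    qed
    \<comment> \<open>The forcing outside the leading harmonics: the feedback through
      \<open>S - S0\<close>, and the remainder of second order in \<epsilon> from squaring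
      \<open>\<nu> \<epsilon>\<close>.\<close>
    define g where "g k t = - D k * (\<epsilon> * (force c d (S t) - force c d (S0 t)))
      + \<epsilon>\<^sup>2 * \<kappa>\<^sup>2 * amp k * cos (\<nu> \<epsilon> * t)" for k t
    define \<beta> where "\<beta> k m = - D k * \<epsilon> * b m" for k m
    \<comment> \<open>Subtracting the comparison motion adds a term with the factor
      \<open>(\<nu> \<epsilon>)\<^sup>2 - (\<omega> k)\<^sup>2\<close>. It is present only for
      \<open>k = j\<close>, where it meets the harmonic \<open>m = 1\<close> that \<open>N j\<close>
      leaves out.\<close>
    have forcing: "- D k * (\<epsilon> * force c d (S t)) + amp k * ((\<nu> \<epsilon>)\<^sup>2 - (\<omega> k)\<^sup>2) * cos (\<nu> \<epsilon> * t)
        = (\<Sum>m\<in>N k. \<beta> k m * cos (real m * \<nu> \<epsilon> * t)) + g k t" for k t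
    proof -
      have "(\<Sum>m\<in>N k. b m * cos (real m * \<nu> \<epsilon> * t))
          = (\<Sum>m\<le>3. b m * cos (real m * \<nu> \<epsilon> * t)) - (if k = j then b 1 * cos (\<nu> \<epsilon> * t) else 0)"
        by (simp add: N_def sum_diff1)
      also have "(\<Sum>m\<le>3. b m * cos (real m * \<nu> \<epsilon> * t)) = force c d (S0 t)"
        unfolding b_def S0_def force_cos by (simp add: mult.assoc)
      finally have 0: "(\<Sum>m\<in>N k. b m * cos (real m * \<nu> \<epsilon> * t))
          = force c d (S0 t) - (if k = j then b 1 * cos (\<nu> \<epsilon> * t) else 0)" .
      have 1: "(\<Sum>m\<in>N k. \<beta> k m * cos (real m * \<nu> \<epsilon> * t))
          = - D k * \<epsilon> * (force c d (S0 t) - (if k = j then b 1 * cos (\<nu> \<epsilon> * t) else 0))"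
        unfolding \<beta>_def 0[symmetric] sum_distrib_left by (simp add: mult.assoc)
      \<comment> \<open>the frequency shift cancels the resonant harmonic of the cubic term\<close>
      have 2: "a * ((\<nu> \<epsilon>)\<^sup>2 - (\<omega> j)\<^sup>2) = D j * \<epsilon> * b 1 + \<epsilon>\<^sup>2 * \<kappa>\<^sup>2 * a"
        using \<omega>[OF j] unfolding \<nu> \<kappa>_def b_def harmonic_def
        by (simp add: field_simps power2_eq_square power3_eq_cube power4_eq_xxxx)
      show ?thesis
        unfolding 1 g_def using 2 by (simp add: amp_def algebra_simps)
    qed
    have u: "(u k has_real_derivative u' k t) (at t within {0..T})"
      and u'': "(u' k has_real_derivative ((\<Sum>m\<in>N k. \<beta> k m * cos (real m * \<nu> \<epsilon> * t)) + g k t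
        - (\<omega> k)\<^sup>2 * u k t)) (at t within {0..T})" if k: "k \<in> I" and t: "t \<in> {0..T}" for k t
    proof -
      note zk = coupled_modesD(2,3)[OF z k, folded T_def S_def, OF t]
      show "(u k has_real_derivative u' k t) (at t within {0..T})"
        unfolding u_def u'_def using zk(1) by (auto intro!: derivative_eq_intros)
      show "(u' k has_real_derivative ((\<Sum>m\<in>N k. \<beta> k m * cos (real m * \<nu> \<epsilon> * t)) + g k t
        - (\<omega> k)\<^sup>2 * u k t)) (at t within {0..T})"
        unfolding forcing[symmetric] unfolding u_def u'_def using zk(2)
        by (auto intro!: derivative_eq_intros simp: algebra_simps power2_eq_square)
    qed
    have u'0: "u' k 0 = 0" if "k \<in> I" for k
      using coupled_modesD(1)[OF z that] by (simp add: u'_def)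
    have u0: "\<bar>u k 0\<bar> \<le> C0 * \<epsilon>" if "k \<in> I" for k
      using init that by (simp add: u_def)

    \<comment> \<open>The supremum of the coupling error\<close>
    obtain \<tau> where \<tau>: "\<tau> \<in> {0..T}" and max: "\<And>t. t \<in> {0..T} \<Longrightarrow> \<bar>S t - S0 t\<bar> \<le> \<bar>S \<tau> - S0 \<tau>\<bar>"
    proof -
      have "continuous_on {0..T} (\<lambda>t. \<bar>S t - S0 t\<bar>)"
        unfolding S0_def using coupled_modes_continuous[OF z, folded T_def S_def]
        by (intro continuous_on_rabs continuous_on_diff) (auto intro!: continuous_intros)
      then show ?thesis
        using continuous_attains_sup[of "{0..T}" "\<lambda>t. \<bar>S t - S0 t\<bar>"] T(1) that by auto
    qed
    define \<sigma> where "\<sigma> = \<bar>S \<tau> - S0 \<tau>\<bar>"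
    have \<sigma>: "\<bar>S t - S0 t\<bar> \<le> \<sigma>" if "t \<in> {0..T}" for t
      using max[OF that] by (simp add: \<sigma>_def)
    have g: "\<bar>g k t\<bar> \<le> \<epsilon> * (\<bar>D k\<bar> * (L * \<sigma>) + \<epsilon> * (\<kappa>\<^sup>2 * \<bar>a\<bar>))" if "t \<in> {0..T}" for k t
    proof -
      have "\<bar>force c d (S t) - force c d (S0 t)\<bar> \<le> L * \<sigma>"
        using lip[OF SR[OF that] S0R] mult_left_mono[OF \<sigma>[OF that] L] by (rule order_trans)
      then have "\<bar>D k\<bar> * (\<epsilon> * \<bar>force c d (S t) - force c d (S0 t)\<bar>) \<le> \<bar>D k\<bar> * (\<epsilon> * (L * \<sigma>))"
        using \<epsilon> by (intro mult_left_mono) auto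
      moreover have "\<epsilon>\<^sup>2 * \<kappa>\<^sup>2 * \<bar>amp k\<bar> * \<bar>cos (\<nu> \<epsilon> * t)\<bar> \<le> \<epsilon>\<^sup>2 * \<kappa>\<^sup>2 * \<bar>a\<bar> * 1"
        by (intro mult_mono) (auto simp: amp_def)
      moreover have "\<bar>g k t\<bar> \<le> \<bar>D k\<bar> * (\<epsilon> * \<bar>force c d (S t) - force c d (S0 t)\<bar>)
          + \<epsilon>\<^sup>2 * \<kappa>\<^sup>2 * \<bar>amp k\<bar> * \<bar>cos (\<nu> \<epsilon> * t)\<bar>"
        unfolding g_def using \<epsilon> by (intro order_trans[OF abs_triangle_ineq]) (simp add: abs_mult)
      ultimately show ?thesis
        by (simp add: algebra_simps power2_eq_square)
    qed
    have \<beta>: "(\<Sum>m\<in>N k. \<bar>\<beta> k m\<bar>) \<le> \<epsilon> * \<bar>D k\<bar> * B" for k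
    proof -
      have "(\<Sum>m\<in>N k. \<bar>\<beta> k m\<bar>) = \<epsilon> * \<bar>D k\<bar> * (\<Sum>m\<in>N k. \<bar>b m\<bar>)"
        using \<epsilon> by (simp add: \<beta>_def abs_mult sum_distrib_left mult_ac)
      then show ?thesis
        using B[of k] \<epsilon> by (simp add: mult_left_mono)
    qed
    have \<nu>1: "\<bar>\<nu> \<epsilon>\<bar> \<le> \<nu>1"
    proof -
      have "\<bar>\<epsilon> * \<kappa>\<bar> \<le> \<bar>\<kappa>\<bar>" using \<epsilon> by (simp add: abs_mult mult_left_le_one_le)
      then show ?thesis using \<omega>[OF j] unfolding \<nu> \<nu>1_def by linarith
    qed
    have \<beta>': "(\<Sum>m\<in>N k. \<bar>\<beta> k m\<bar> * (real m * \<bar>\<nu> \<epsilon>\<bar>)) \<le> \<epsilon> * \<bar>D k\<bar> * B * (3 * \<nu>1)" for k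
    proof -
      have "(\<Sum>m\<in>N k. \<bar>\<beta> k m\<bar> * (real m * \<bar>\<nu> \<epsilon>\<bar>)) \<le> (\<Sum>m\<in>N k. \<bar>\<beta> k m\<bar> * (3 * \<nu>1))"
        using N(2)[of k] \<nu>1 by (intro sum_mono mult_left_mono mult_mono) auto
      also have "\<dots> \<le> \<epsilon> * \<bar>D k\<bar> * B * (3 * \<nu>1)"
        unfolding sum_distrib_right[symmetric] using \<beta> \<open>0 \<le> \<nu>1\<close> by (intro mult_right_mono) auto
      finally show ?thesis .
    qed
    \<comment> \<open>The bound \<open>H\<close> is left free because the estimate is applied twice:
      with a bound in terms of \<sigma>, to control \<sigma> itself, and then with the bound of
      order \<open>\<epsilon>\<^sup>2\<close> that results.\<close>
    have estimate:
      "\<bar>u k t\<bar> \<le> \<epsilon> * (C0 + 2 * \<bar>D k\<bar> * B / \<eta>) + t * H / \<omega> k"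
      "\<bar>u' k t\<bar> \<le> \<epsilon> * (\<omega> k * C0 + \<omega> k * \<bar>D k\<bar> * B / \<eta> + 3 * \<nu>1 * \<bar>D k\<bar> * B / \<eta>) + t * H"
      if k: "k \<in> I" and t: "t \<in> {0..T}" and H: "\<And>s. s \<in> {0..T} \<Longrightarrow> \<bar>g k s\<bar> \<le> H" for k t H
    proof -
      have t0: "0 \<le> t" using t by simp
      have *: "(u k has_real_derivative u' k s) (at s within {0..t})"
        "(u' k has_real_derivative ((\<Sum>m\<in>N k. \<beta> k m * cos (real m * \<nu> \<epsilon> * s)) + g k s
          - (\<omega> k)\<^sup>2 * u k s)) (at s within {0..t})" if "s \<in> {0..t}" for s
      proof -
        have s: "s \<in> {0..T}" and sub: "{0..t} \<subseteq> {0..T}" using that t by auto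
        show "(u k has_real_derivative u' k s) (at s within {0..t})"
          "(u' k has_real_derivative ((\<Sum>m\<in>N k. \<beta> k m * cos (real m * \<nu> \<epsilon> * s)) + g k s
            - (\<omega> k)\<^sup>2 * u k s)) (at s within {0..t})"
          by (rule has_field_derivative_subset[OF u[OF k s] sub]
              has_field_derivative_subset[OF u''[OF k s] sub])+
      qed
      have gH: "\<bar>g k s\<bar> \<le> H" if "s \<in> {0<..<t}" for s
        using that t by (intro H) auto
      note est = nonresonant_bound[OF \<omega>[OF k] t0 \<eta> gap[OF k] u'0[OF k] * gH]
      have "(\<Sum>m\<in>N k. \<bar>\<beta> k m\<bar>) / \<eta> \<le> \<epsilon> * \<bar>D k\<bar> * B / \<eta>"
        using \<beta> \<eta> by (simp add: divide_right_mono)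
      moreover have "\<omega> k * (\<Sum>m\<in>N k. \<bar>\<beta> k m\<bar>) / \<eta> \<le> \<omega> k * (\<epsilon> * \<bar>D k\<bar> * B) / \<eta>"
        using \<beta> \<eta> \<omega>[OF k] by (intro divide_right_mono mult_left_mono) auto
      moreover have "(\<Sum>m\<in>N k. \<bar>\<beta> k m\<bar> * (real m * \<bar>\<nu> \<epsilon>\<bar>)) / \<eta> \<le> \<epsilon> * \<bar>D k\<bar> * B * (3 * \<nu>1) / \<eta>"
        using \<beta>' \<eta> by (simp add: divide_right_mono)
      moreover have "\<omega> k * \<bar>u k 0\<bar> \<le> \<omega> k * (C0 * \<epsilon>)"
        using u0[OF k] \<omega>[OF k] by (simp add: mult_left_mono)
      moreover have "2 * (\<Sum>m\<in>N k. \<bar>\<beta> k m\<bar>) / \<eta> = 2 * ((\<Sum>m\<in>N k. \<bar>\<beta> k m\<bar>) / \<eta>)"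
        by simp
      moreover have "\<epsilon> * (C0 + 2 * \<bar>D k\<bar> * B / \<eta>) = C0 * \<epsilon> + 2 * (\<epsilon> * \<bar>D k\<bar> * B / \<eta>)"
        by (simp add: distrib_left)
      moreover have "\<epsilon> * (\<omega> k * C0 + \<omega> k * \<bar>D k\<bar> * B / \<eta> + 3 * \<nu>1 * \<bar>D k\<bar> * B / \<eta>)
          = \<omega> k * (C0 * \<epsilon>) + \<omega> k * (\<epsilon> * \<bar>D k\<bar> * B) / \<eta> + \<epsilon> * \<bar>D k\<bar> * B * (3 * \<nu>1) / \<eta>"
        by (simp add: distrib_left mult_ac)
      ultimately show
        "\<bar>u k t\<bar> \<le> \<epsilon> * (C0 + 2 * \<bar>D k\<bar> * B / \<eta>) + t * H / \<omega> k"
        "\<bar>u' k t\<bar> \<le> \<epsilon> * (\<omega> k * C0 + \<omega> k * \<bar>D k\<bar> * B / \<eta> + 3 * \<nu>1 * \<bar>D k\<bar> * B / \<eta>) + t * H"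
        using est u0[OF k] by linarith+
    qed
    \<comment> \<open>The length \<open>\<gamma> / \<epsilon>\<close> of the time interval uses up
      exactly one factor \<epsilon> of the forcing.\<close>
    have scale: "t * (\<epsilon> * x) \<le> \<gamma> * x" if "t \<in> {0..T}" "0 \<le> x" for t x
    proof -
      have "t * (\<epsilon> * x) \<le> T * (\<epsilon> * x)" using that \<epsilon> by (intro mult_right_mono) auto
      then show ?thesis by (simp add: T(2) flip: mult.assoc)
    qed
    have "0 \<le> \<sigma>" by (simp add: \<sigma>_def)
    have "\<sigma> \<le> (\<Sum>k\<in>I. \<bar>D k\<bar> * \<bar>u k \<tau>\<bar>)"
      unfolding \<sigma>_def Su by (rule order_trans[OF sum_abs]) (simp add: abs_mult)
    also have "\<dots> \<le> (\<Sum>k\<in>I. \<epsilon> * (\<bar>D k\<bar> * A k) + \<gamma> * L * \<sigma> * ((D k)\<^sup>2 / \<omega> k))"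
    proof (rule sum_mono)
      fix k assume k: "k \<in> I"
      let ?x = "\<bar>D k\<bar> * (L * \<sigma>) + \<epsilon> * (\<kappa>\<^sup>2 * \<bar>a\<bar>)"
      have "0 \<le> ?x" using L \<open>0 \<le> \<sigma>\<close> \<epsilon> by simp
      have "\<bar>u k \<tau>\<bar> \<le> \<epsilon> * (C0 + 2 * \<bar>D k\<bar> * B / \<eta>) + \<tau> * (\<epsilon> * ?x) / \<omega> k"
        using k \<tau> g by (rule estimate)
      also have "\<tau> * (\<epsilon> * ?x) / \<omega> k \<le> \<gamma> * ?x / \<omega> k"
        using scale[OF \<tau> \<open>0 \<le> ?x\<close>] \<omega>[OF k] by (simp add: divide_right_mono)
      also have "\<epsilon> * (C0 + 2 * \<bar>D k\<bar> * B / \<eta>) + \<gamma> * ?x / \<omega> k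
          = \<epsilon> * A k + \<gamma> * \<bar>D k\<bar> * (L * \<sigma>) / \<omega> k"
        by (simp add: A_def algebra_simps add_divide_distrib)
      finally have "\<bar>D k\<bar> * \<bar>u k \<tau>\<bar> \<le> \<bar>D k\<bar> * (\<epsilon> * A k + \<gamma> * \<bar>D k\<bar> * (L * \<sigma>) / \<omega> k)"
        by (simp add: mult_left_mono)
      also have "\<dots> = \<epsilon> * (\<bar>D k\<bar> * A k) + \<gamma> * L * \<sigma> * ((D k)\<^sup>2 / \<omega> k)"
        using abs_mult_self_eq[of "D k"]
        by (simp add: distrib_left power2_eq_square mult.commute mult.left_commute)
      finally show "\<bar>D k\<bar> * \<bar>u k \<tau>\<bar> \<le> \<epsilon> * (\<bar>D k\<bar> * A k) + \<gamma> * L * \<sigma> * ((D k)\<^sup>2 / \<omega> k)" .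
    qed
    also have "\<dots> = \<epsilon> * E + \<gamma> * L * W * \<sigma>"
      unfolding sum.distrib sum_distrib_left[symmetric] E_def W_def by simp
    \<comment> \<open>The choice of a small \<gamma> pays off here: half of \<sigma> moves to the
      left-hand side.\<close>
    also have "\<gamma> * L * W * \<sigma> \<le> 1 / 2 * \<sigma>"
      using small \<open>0 \<le> \<sigma>\<close> unfolding W_def by (intro mult_right_mono)
    finally have \<sigma>E: "\<sigma> \<le> \<epsilon> * (2 * E)" by simp
    \<comment> \<open>The sign of \<open>C0\<close> is left open, so the sign of \<open>E\<close> is
      read off from \<open>0 \<le> \<sigma> \<le> \<epsilon> * (2 * E)\<close>.\<close>
    have "0 \<le> E"
    proof -
      have "0 \<le> \<epsilon> * (2 * E)" using \<open>0 \<le> \<sigma>\<close> \<sigma>E by linarith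
      then show ?thesis using \<epsilon> by (simp add: zero_le_mult_iff)
    qed

    \<comment> \<open>Bounds for the error and its first two derivatives\<close>
    have g': "\<bar>g k t\<bar> \<le> \<epsilon> * (\<epsilon> * G (2 * E) k)" if "t \<in> {0..T}" for k t
    proof -
      have "\<bar>D k\<bar> * (L * \<sigma>) \<le> \<bar>D k\<bar> * (L * (\<epsilon> * (2 * E)))"
        using \<sigma>E L by (intro mult_left_mono) auto
      then have "\<bar>D k\<bar> * (L * \<sigma>) + \<epsilon> * (\<kappa>\<^sup>2 * \<bar>a\<bar>) \<le> \<epsilon> * G (2 * E) k"
        by (simp add: G_def algebra_simps)
      then have "\<epsilon> * (\<bar>D k\<bar> * (L * \<sigma>) + \<epsilon> * (\<kappa>\<^sup>2 * \<bar>a\<bar>)) \<le> \<epsilon> * (\<epsilon> * G (2 * E) k)"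
        using \<epsilon> by (intro mult_left_mono) auto
      with g[OF that, of k] show ?thesis by linarith
    qed
    have G0: "0 \<le> \<epsilon> * G (2 * E) k" for k
      using \<open>0 \<le> E\<close> L \<epsilon> by (simp add: G_def)
    show "\<forall>k\<in>I. \<forall>t\<in>{0..\<gamma> / \<epsilon>}.
        \<bar>z k t - amp k * cos (\<nu> \<epsilon> * t)\<bar> \<le> C * \<epsilon> \<and>
        \<bar>z' k t + amp k * \<nu> \<epsilon> * sin (\<nu> \<epsilon> * t)\<bar> \<le> C * \<epsilon> \<and>
        \<bar>- D k * (\<epsilon> * force c d (\<Sum>i\<in>I. D i * z i t)) - (\<omega> k)\<^sup>2 * z k t
          + amp k * (\<nu> \<epsilon>)\<^sup>2 * cos (\<nu> \<epsilon> * t)\<bar> \<le> C * \<epsilon>"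
      unfolding T_def[symmetric] S_def[symmetric]
    proof (intro ballI conjI)
      fix k t assume k: "k \<in> I" and t: "t \<in> {0..T}"
      have up: "x \<le> C * \<epsilon>" if "x \<le> \<epsilon> * y" "y \<le> C" for x y
      proof -
        have "\<epsilon> * y \<le> \<epsilon> * C" using that(2) \<epsilon> by (intro mult_left_mono) auto
        with that(1) show ?thesis by (simp add: mult.commute)
      qed
      have tG: "t * (\<epsilon> * (\<epsilon> * G (2 * E) k)) \<le> \<gamma> * (\<epsilon> * G (2 * E) k)"
        using t G0 by (rule scale)
      have "\<bar>u k t\<bar> \<le> \<epsilon> * (C0 + 2 * \<bar>D k\<bar> * B / \<eta>) + t * (\<epsilon> * (\<epsilon> * G (2 * E) k)) / \<omega> k"
        using k t g' by (rule estimate)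
      also have "\<dots> \<le> \<epsilon> * (C0 + 2 * \<bar>D k\<bar> * B / \<eta>) + \<gamma> * (\<epsilon> * G (2 * E) k) / \<omega> k"
        using tG \<omega>[OF k] by (simp add: divide_right_mono)
      also have "\<dots> = \<epsilon> * C1 k"
        by (simp add: C1_def algebra_simps)
      finally have u1: "\<bar>u k t\<bar> \<le> \<epsilon> * C1 k" .
      then show "\<bar>z k t - amp k * cos (\<nu> \<epsilon> * t)\<bar> \<le> C * \<epsilon>"
        unfolding u_def using C(1)[OF k] by (rule up)
      have "\<bar>u' k t\<bar> \<le> \<epsilon> * (\<omega> k * C0 + \<omega> k * \<bar>D k\<bar> * B / \<eta> + 3 * \<nu>1 * \<bar>D k\<bar> * B / \<eta>)
          + t * (\<epsilon> * (\<epsilon> * G (2 * E) k))"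
        using k t g' by (rule estimate)
      also have "\<dots> \<le> \<epsilon> * (\<omega> k * C0 + \<omega> k * \<bar>D k\<bar> * B / \<eta> + 3 * \<nu>1 * \<bar>D k\<bar> * B / \<eta>)
          + \<gamma> * (\<epsilon> * G (2 * E) k)"
        using tG by simp
      also have "\<dots> = \<epsilon> * C2 k"
        by (simp add: C2_def algebra_simps)
      finally show "\<bar>z' k t + amp k * \<nu> \<epsilon> * sin (\<nu> \<epsilon> * t)\<bar> \<le> C * \<epsilon>"
        unfolding u'_def using C(2)[OF k] by (rule up)
      \<comment> \<open>The second derivative of the error is bounded through its equation:
        nonlinear force, frequency mismatch and restoring force are each of order \<epsilon>. The
        first of these uses that the force vanishes at 0.\<close>
      have "\<bar>force c d (S t)\<bar> \<le> L * R"
      proof -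
        have "0 \<le> R" using SR[OF t] by linarith
        then have "\<bar>force c d (S t)\<bar> \<le> L * \<bar>S t\<bar>"
          using lip[OF SR[OF t], of 0] by (simp add: force_def)
        also have "\<dots> \<le> L * R" using SR[OF t] L by (rule mult_left_mono)
        finally show ?thesis .
      qed
      then have 1: "\<bar>- D k * (\<epsilon> * force c d (S t))\<bar> \<le> \<epsilon> * (\<bar>D k\<bar> * (L * R))"
        using mult_left_mono[of "\<bar>force c d (S t)\<bar>" "L * R" "\<epsilon> * \<bar>D k\<bar>"] \<epsilon>
        by (simp add: abs_mult mult_ac)
      have "\<bar>amp k * ((\<nu> \<epsilon>)\<^sup>2 - (\<omega> k)\<^sup>2)\<bar> \<le> \<epsilon> * (\<bar>a\<bar> * (2 * \<omega> j * \<bar>\<kappa>\<bar> + \<kappa>\<^sup>2))"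
      proof (cases "k = j")
        case True
        have "(\<nu> \<epsilon>)\<^sup>2 - (\<omega> j)\<^sup>2 = \<epsilon> * (2 * \<omega> j * \<kappa> + \<epsilon> * \<kappa>\<^sup>2)"
          by (simp add: \<nu> power2_eq_square algebra_simps)
        moreover have "\<bar>2 * \<omega> j * \<kappa> + \<epsilon> * \<kappa>\<^sup>2\<bar> \<le> 2 * \<omega> j * \<bar>\<kappa>\<bar> + \<kappa>\<^sup>2"
        proof -
          have "\<bar>2 * \<omega> j * \<kappa> + \<epsilon> * \<kappa>\<^sup>2\<bar> \<le> 2 * \<omega> j * \<bar>\<kappa>\<bar> + \<epsilon> * \<kappa>\<^sup>2"
            using \<epsilon> \<omega>[OF j] by (intro order_trans[OF abs_triangle_ineq]) (simp add: abs_mult)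
          also have "\<epsilon> * \<kappa>\<^sup>2 \<le> \<kappa>\<^sup>2" using \<epsilon> by (simp add: mult_left_le_one_le)
          finally show ?thesis by simp
        qed
        ultimately show ?thesis
          using True \<epsilon> by (simp add: amp_def abs_mult mult_left_mono mult.left_commute)
      next
        case False
        then show ?thesis using \<epsilon> \<omega>[OF j] by (simp add: amp_def)
      qed
      moreover have "\<bar>amp k * ((\<nu> \<epsilon>)\<^sup>2 - (\<omega> k)\<^sup>2) * cos (\<nu> \<epsilon> * t)\<bar> \<le> \<bar>amp k * ((\<nu> \<epsilon>)\<^sup>2 - (\<omega> k)\<^sup>2)\<bar>"
        unfolding abs_mult[of _ "cos _"] by (intro mult_left_le) auto
      ultimately have 2: "\<bar>amp k * ((\<nu> \<epsilon>)\<^sup>2 - (\<omega> k)\<^sup>2) * cos (\<nu> \<epsilon> * t)\<bar>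
          \<le> \<epsilon> * (\<bar>a\<bar> * (2 * \<omega> j * \<bar>\<kappa>\<bar> + \<kappa>\<^sup>2))"
        by linarith
      have 3: "\<bar>(\<omega> k)\<^sup>2 * u k t\<bar> \<le> \<epsilon> * ((\<omega> k)\<^sup>2 * C1 k)"
        using mult_left_mono[OF u1, of "(\<omega> k)\<^sup>2"] by (simp add: abs_mult mult.left_commute)
      have "- D k * (\<epsilon> * force c d (S t)) - (\<omega> k)\<^sup>2 * z k t + amp k * (\<nu> \<epsilon>)\<^sup>2 * cos (\<nu> \<epsilon> * t)
          = - D k * (\<epsilon> * force c d (S t)) + amp k * ((\<nu> \<epsilon>)\<^sup>2 - (\<omega> k)\<^sup>2) * cos (\<nu> \<epsilon> * t)
            - (\<omega> k)\<^sup>2 * u k t"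
        by (simp add: u_def algebra_simps)
      also have "\<bar>\<dots>\<bar> \<le> \<epsilon> * (\<bar>D k\<bar> * (L * R)) + \<epsilon> * (\<bar>a\<bar> * (2 * \<omega> j * \<bar>\<kappa>\<bar> + \<kappa>\<^sup>2))
          + \<epsilon> * ((\<omega> k)\<^sup>2 * C1 k)"
        using 1 2 3 by linarith
      also have "\<dots> = \<epsilon> * C3 k"
        by (simp add: C3_def distrib_left)
      finally show "\<bar>- D k * (\<epsilon> * force c d (S t)) - (\<omega> k)\<^sup>2 * z k t
          + amp k * (\<nu> \<epsilon>)\<^sup>2 * cos (\<nu> \<epsilon> * t)\<bar> \<le> C * \<epsilon>"
        using C(3)[OF k] by (rule up)
    qed
  qed
qed

text \<open>The expansion is claimed for every modal solution, so an arbitrary one has to be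
  rescaled by \<open>y = \<epsilon> z\<close>, with the velocities that its definition hides made
  available.\<close>

lemma coupled_modes_of_modal_solution:
  fixes \<phi> :: "nat \<Rightarrow> real vec"
  assumes "\<epsilon> > 0" and "modal_solution n p c d \<omega> \<phi> \<epsilon> y0 T y"
  obtains z' where "coupled_modes {1..n} \<omega> (\<lambda>k. delta p (\<phi> k)) (\<lambda>x. \<epsilon> * force c d x) T
      (\<lambda>k t. y k t / \<epsilon>) z'"
    and "\<And>k. k \<in> {1..n} \<Longrightarrow> y k 0 = y0 k"
proof -
  let ?S = "\<lambda>t. \<Sum>i=1..n. y i t * delta p (\<phi> i)"
  obtain y' y'' where *: "\<And>k. k \<in> {1..n} \<Longrightarrow> y k 0 = y0 k \<and> y' k 0 = 0 \<and>
      (\<forall>t\<in>{0..T}.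
         (y k has_real_derivative y' k t) (at t within {0..T}) \<and>
         (y' k has_real_derivative y'' k t) (at t within {0..T}) \<and>
         y'' k t + (\<omega> k)\<^sup>2 * y k t +
           delta p (\<phi> k) * (c * (?S t)\<^sup>2 + d / \<epsilon> * ?S t ^ 3) = 0)"
    using assms(2) unfolding modal_solution_def by blast
  have S: "(\<Sum>i=1..n. delta p (\<phi> i) * (y i t / \<epsilon>)) = ?S t / \<epsilon>" for t
    by (simp add: sum_divide_distrib mult.commute)
  have "coupled_modes {1..n} \<omega> (\<lambda>k. delta p (\<phi> k)) (\<lambda>x. \<epsilon> * force c d x) T
      (\<lambda>k t. y k t / \<epsilon>) (\<lambda>k t. y' k t / \<epsilon>)"
    unfolding coupled_modes_def S
  proof (intro ballI conjI)
    fix k t assume k: "k \<in> {1..n}" and t: "t \<in> {0..T}"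
    show "((\<lambda>t. y k t / \<epsilon>) has_real_derivative y' k t / \<epsilon>) (at t within {0..T})"
      using *[OF k] t by (intro DERIV_cdivide) blast
    have "y'' k t = - (\<omega> k)\<^sup>2 * y k t - delta p (\<phi> k) * (c * (?S t)\<^sup>2 + d / \<epsilon> * ?S t ^ 3)"
      using *[OF k] t by (auto simp: algebra_simps eq_neg_iff_add_eq_0)
    have "y'' k t / \<epsilon> = - delta p (\<phi> k) * (\<epsilon> * force c d (?S t / \<epsilon>)) - (\<omega> k)\<^sup>2 * (y k t / \<epsilon>)"
      unfolding \<open>y'' k t = _\<close> using \<open>\<epsilon> > 0\<close> by (simp add: force_def field_simps power2_eq_square power3_eq_cube)
    then show "((\<lambda>t. y' k t / \<epsilon>) has_real_derivative
        - delta p (\<phi> k) * (\<epsilon> * force c d (?S t / \<epsilon>)) - (\<omega> k)\<^sup>2 * (y k t / \<epsilon>)) (at t within {0..T})"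
      using *[OF k] t DERIV_cdivide[of "y' k" "y'' k t" t "{0..T}" \<epsilon>] by simp
  qed (use * in simp)
  with that * show thesis by blast
qed

lemma modal_solution_of_coupled_modes:
  fixes \<phi> :: "nat \<Rightarrow> real vec"
  assumes "\<epsilon> > 0"
    and z: "coupled_modes {1..n} \<omega> (\<lambda>k. delta p (\<phi> k)) (\<lambda>x. \<epsilon> * force c d x) T z z'"
    and z0: "\<And>k. k \<in> {1..n} \<Longrightarrow> z k 0 = y0 k / \<epsilon>"
  shows "modal_solution n p c d \<omega> \<phi> \<epsilon> y0 T (\<lambda>k t. \<epsilon> * z k t)"
proof -
  let ?S = "\<lambda>t. \<Sum>i=1..n. delta p (\<phi> i) * z i t"
  let ?z'' = "\<lambda>k t. - delta p (\<phi> k) * (\<epsilon> * force c d (?S t)) - (\<omega> k)\<^sup>2 * z k t"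
  have S: "(\<Sum>i=1..n. \<epsilon> * z i t * delta p (\<phi> i)) = \<epsilon> * ?S t" for t
    by (simp add: sum_distrib_left mult_ac)
  show ?thesis
    unfolding modal_solution_def S
  proof (rule exI[of _ "\<lambda>k t. \<epsilon> * z' k t"], rule exI[of _ "\<lambda>k t. \<epsilon> * ?z'' k t"],
      intro ballI conjI)
    fix k t assume k: "k \<in> {1..n}" and t: "t \<in> {0..T}"
    show "((\<lambda>t. \<epsilon> * z k t) has_real_derivative \<epsilon> * z' k t) (at t within {0..T})"
      using coupled_modesD(2)[OF z k t] by (rule DERIV_cmult)
    show "((\<lambda>t. \<epsilon> * z' k t) has_real_derivative \<epsilon> * ?z'' k t) (at t within {0..T})"
      using coupled_modesD(3)[OF z k t] by (rule DERIV_cmult)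
    show "\<epsilon> * ?z'' k t + (\<omega> k)\<^sup>2 * (\<epsilon> * z k t)
        + delta p (\<phi> k) * (c * (\<epsilon> * ?S t)\<^sup>2 + d / \<epsilon> * (\<epsilon> * ?S t) ^ 3) = 0"
      using \<open>\<epsilon> > 0\<close> by (simp add: force_def field_simps power2_eq_square power3_eq_cube)
  qed (use z0 coupled_modesD(1)[OF z] \<open>\<epsilon> > 0\<close> in auto)
qed

text \<open>The three bounded quantities are the error and its successive derivatives, so division
  by \<epsilon> gives the claim. The second derivative is continuous because the equation expresses
  it through the continuous functions \<open>z k\<close> and the coupling scalar. Unexcited modes
  are the case \<open>A = 0\<close>.\<close>

lemma coupled_modes_imp_C2_bounded:
  assumes z: "coupled_modes I \<omega> D (\<lambda>x. \<epsilon> * force c d x) T z z'" and k: "k \<in> I" and "\<epsilon> > 0"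
    and bnd: "\<And>t. t \<in> {0..T} \<Longrightarrow>
      \<bar>z k t - A * cos (\<nu> * t)\<bar> \<le> C * \<epsilon> \<and> \<bar>z' k t + A * \<nu> * sin (\<nu> * t)\<bar> \<le> C * \<epsilon> \<and>
      \<bar>- D k * (\<epsilon> * force c d (\<Sum>i\<in>I. D i * z i t)) - (\<omega> k)\<^sup>2 * z k t
        + A * \<nu>\<^sup>2 * cos (\<nu> * t)\<bar> \<le> C * \<epsilon>"
  shows "C2_bounded_by C T (\<lambda>t. (z k t - A * cos (\<nu> * t)) / \<epsilon>)"
proof -
  let ?z'' = "\<lambda>t. - D k * (\<epsilon> * force c d (\<Sum>i\<in>I. D i * z i t)) - (\<omega> k)\<^sup>2 * z k t"
  have at: "(z k has_real_derivative z' k t) (at t)" "(z' k has_real_derivative ?z'' t) (at t)"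
    if "t \<in> {0<..<T}" for t
    using coupled_modesD(2,3)[OF z k, of t] that by (simp_all add: at_within_Icc_at)
  show ?thesis
    unfolding C2_bounded_by_def
  proof (rule exI[of _ "\<lambda>t. (z' k t + A * \<nu> * sin (\<nu> * t)) / \<epsilon>"],
      rule exI[of _ "\<lambda>t. (?z'' t + A * \<nu>\<^sup>2 * cos (\<nu> * t)) / \<epsilon>"], intro conjI ballI)
    have "continuous_on {0..T} (z k)"
      using coupled_modesD(2)[OF z k] by (rule DERIV_continuous_on)
    then have "continuous_on {0..T} (\<lambda>t. (?z'' t + A * \<nu>\<^sup>2 * cos (\<nu> * t)) / \<epsilon>)"
      unfolding force_def using coupled_modes_continuous[OF z] \<open>\<epsilon> > 0\<close>
      by (intro continuous_on_divide continuous_on_add continuous_on_diff continuous_on_mult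
          continuous_on_power continuous_on_const continuous_on_cos continuous_on_id) auto
    then show "continuous_on {0<..<T} (\<lambda>t. (?z'' t + A * \<nu>\<^sup>2 * cos (\<nu> * t)) / \<epsilon>)"
      by (rule continuous_on_subset) auto
  next
    fix t assume t: "t \<in> {0<..<T}"
    show "((\<lambda>t. (z k t - A * cos (\<nu> * t)) / \<epsilon>) has_real_derivative
        (z' k t + A * \<nu> * sin (\<nu> * t)) / \<epsilon>) (at t)"
      by (rule DERIV_cdivide) (use at(1)[OF t] in \<open>auto intro!: derivative_eq_intros\<close>)
    show "((\<lambda>t. (z' k t + A * \<nu> * sin (\<nu> * t)) / \<epsilon>) has_real_derivative
        (?z'' t + A * \<nu>\<^sup>2 * cos (\<nu> * t)) / \<epsilon>) (at t)"
      by (rule DERIV_cdivide)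
        (use at(2)[OF t] in \<open>auto intro!: derivative_eq_intros simp: power2_eq_square\<close>)
    have "t \<in> {0..T}" using t by simp
    from bnd[OF this] \<open>\<epsilon> > 0\<close>
    show "\<bar>(z k t - A * cos (\<nu> * t)) / \<epsilon>\<bar> \<le> C" "\<bar>(z' k t + A * \<nu> * sin (\<nu> * t)) / \<epsilon>\<bar> \<le> C"
      "\<bar>(?z'' t + A * \<nu>\<^sup>2 * cos (\<nu> * t)) / \<epsilon>\<bar> \<le> C"
      by (simp_all add: abs_div_pos[symmetric] pos_divide_le_eq)
  qed
qed

theorem proposition3p1:
  fixes n p :: nat and c d a10 :: real and M K :: "real mat"
    and \<omega> :: "nat \<Rightarrow> real" and \<phi> :: "nat \<Rightarrow> real vec"
    and y0 :: "nat \<Rightarrow> real \<Rightarrow> real"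
  assumes "n \<ge> 2" and "p \<in> {2..n}"
    and "sym_pos_def n M" and "sym_pos_def n K"
    and "generalized_modes n M K \<omega> \<phi>"
    and "\<forall>k\<in>{1..n}. k \<noteq> 1 \<longrightarrow> Z_independent (\<omega> k) (\<omega> 1)"
    and "y0 1 = (\<lambda>\<epsilon>. \<epsilon> * a10)"
    and "\<forall>k\<in>{1..n}. k \<noteq> 1 \<longrightarrow> y0 k \<in> O[at_right 0](\<lambda>\<epsilon>. \<epsilon>\<^sup>2)"
  defines "\<nu> \<equiv> \<lambda>\<epsilon>. \<omega> 1 + 3 * \<epsilon> * (d * a10\<^sup>2 / (8 * \<omega> 1)) *
                    (component (\<phi> 1) p - component (\<phi> 1) (p - 1)) ^ 4"
  shows "\<exists>\<gamma>>0. \<exists>C. \<forall>\<^sub>F \<epsilon> in at_right 0.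
           (\<exists>y. modal_solution n p c d \<omega> \<phi> \<epsilon> (\<lambda>k. y0 k \<epsilon>) (\<gamma> / \<epsilon>) y) \<and>
           (\<forall>y. modal_solution n p c d \<omega> \<phi> \<epsilon> (\<lambda>k. y0 k \<epsilon>) (\<gamma> / \<epsilon>) y \<longrightarrow>
             (\<exists>r. (\<forall>t\<in>{0..\<gamma> / \<epsilon>}.
                     y 1 t = \<epsilon> * a10 * cos (\<nu> \<epsilon> * t) + \<epsilon>\<^sup>2 * r 1 t \<and>
                     (\<forall>k\<in>{1..n}. k \<noteq> 1 \<longrightarrow> y k t = \<epsilon>\<^sup>2 * r k t)) \<and>
                  (\<forall>k\<in>{1..n}. C2_bounded_by C (\<gamma> / \<epsilon>) (r k))))"
proof -

  \<comment> \<open>Initial data of the rescaled system\<close>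
  define I where "I = {1..n}"
  define D where "D k = delta p (\<phi> k)" for k
  define amp where "amp k = (if k = 1 then a10 else 0)" for k :: nat
  have I: "finite I" "1 \<in> I" using assms(1) by (auto simp: I_def)
  have \<omega>: "\<omega> k > 0" if "k \<in> I" for k
    using assms(5) that by (simp add: generalized_modes_def I_def)
  have \<nu>: "\<nu> \<epsilon> = \<omega> 1 + 3 * \<epsilon> * (d * a10\<^sup>2 / (8 * \<omega> 1)) * D 1 ^ 4" for \<epsilon>
    by (simp add: \<nu>_def D_def delta_def)
  define W where "W = (\<Sum>k\<in>I. (D k)\<^sup>2 / \<omega> k)"
  have "0 \<le> W"
    unfolding W_def using \<omega> by (intro sum_nonneg) (simp add: less_imp_le)
  have "\<exists>c. \<forall>\<^sub>F \<epsilon> in at_right 0. \<bar>y0 k \<epsilon> - \<epsilon> * amp k\<bar> \<le> c * \<epsilon>\<^sup>2" if k: "k \<in> I" for k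
  proof (cases "k = 1")
    case True
    then show ?thesis using assms(7) by (intro exI[of _ 0]) (simp add: amp_def)
  next
    case False
    then have "y0 k \<in> O[at_right 0](\<lambda>\<epsilon>. \<epsilon>\<^sup>2)" using assms(8) k by (simp add: I_def)
    then show ?thesis
      using False by (auto elim!: landau_o.bigE simp: amp_def)
  qed
  then obtain q where q: "\<And>k. k \<in> I \<Longrightarrow> \<forall>\<^sub>F \<epsilon> in at_right 0. \<bar>y0 k \<epsilon> - \<epsilon> * amp k\<bar> \<le> q k * \<epsilon>\<^sup>2"
    by metis
  \<comment> \<open>One constant for all modes. Dividing the data by \<epsilon> lowers their error
    from order \<open>\<epsilon>\<^sup>2\<close> to order \<epsilon>.\<close>
  define C0 where "C0 = (\<Sum>k\<in>I. \<bar>q k\<bar>)"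
  have "0 \<le> C0" unfolding C0_def by (intro sum_nonneg) simp
  have qC0: "q k \<le> C0" if "k \<in> I" for k
    using member_le_sum[of k I "\<lambda>k. \<bar>q k\<bar>"] I that unfolding C0_def by simp
  have init: "\<forall>\<^sub>F \<epsilon> in at_right 0. \<forall>k\<in>I. \<bar>y0 k \<epsilon> / \<epsilon> - amp k\<bar> \<le> C0 * \<epsilon>"
  proof (rule eventually_ball_finite[OF I(1)], intro ballI)
    fix k assume k: "k \<in> I"
    show "\<forall>\<^sub>F \<epsilon> in at_right 0. \<bar>y0 k \<epsilon> / \<epsilon> - amp k\<bar> \<le> C0 * \<epsilon>"
      using q[OF k] eventually_at_right_less[of 0]
    proof eventually_elim
      case (elim \<epsilon>)
      have "y0 k \<epsilon> / \<epsilon> - amp k = (y0 k \<epsilon> - \<epsilon> * amp k) / \<epsilon>"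
        using elim(2) by (simp add: diff_divide_distrib)
      then have "\<bar>y0 k \<epsilon> / \<epsilon> - amp k\<bar> = \<bar>y0 k \<epsilon> - \<epsilon> * amp k\<bar> / \<epsilon>"
        using elim(2) by (simp add: abs_divide)
      also have "\<dots> \<le> q k * \<epsilon>\<^sup>2 / \<epsilon>" using elim by (simp add: divide_right_mono)
      also have "\<dots> = q k * \<epsilon>" using elim(2) by (simp add: power2_eq_square)
      also have "\<dots> \<le> C0 * \<epsilon>" using qC0[OF k] elim(2) by (simp add: mult_right_mono)
      finally show ?case .
    qed
  qed

  \<comment> \<open>Nonresonance\<close>
  define N where "N k = {..3} - (if k = (1::nat) then {1::nat} else {})" for k
  have away: "\<exists>\<eta>>0. \<forall>\<^sub>F \<epsilon> in at_right 0. \<forall>x\<in>Sigma I N.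
      \<eta> \<le> \<bar>case x of (k, m) \<Rightarrow> (\<omega> k)\<^sup>2 - (real m * \<nu> \<epsilon>)\<^sup>2\<bar>"
  proof (rule eventually_bounded_away)
    show "finite (Sigma I N)" using I(1) by (simp add: N_def)
    fix x assume x: "x \<in> Sigma I N"
    obtain k m where km: "x = (k, m)" "k \<in> I" "m \<in> N k" using x by blast
    have "((\<lambda>\<epsilon>. \<nu> \<epsilon>) \<longlongrightarrow> \<omega> 1 + 3 * 0 * (d * a10\<^sup>2 / (8 * \<omega> 1)) * D 1 ^ 4) (at_right 0)"
      unfolding \<nu> by (intro tendsto_intros)
    then have "(\<nu> \<longlongrightarrow> \<omega> 1) (at_right 0)" by simp
    then show "((\<lambda>\<epsilon>. case x of (k, m) \<Rightarrow> (\<omega> k)\<^sup>2 - (real m * \<nu> \<epsilon>)\<^sup>2)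
        \<longlongrightarrow> (case x of (k, m) \<Rightarrow> (\<omega> k)\<^sup>2 - (real m * \<omega> 1)\<^sup>2)) (at_right 0)"
      unfolding km(1) prod.case by (intro tendsto_intros)
    \<comment> \<open>For \<open>k = 1\<close> only \<open>m = 1\<close> could be resonant, and
      \<open>N 1\<close> omits it. For the other modes, independence is applied with the
      coefficients \<open>1\<close> and \<open>- m\<close>. Since both sides are nonnegative, their
      squares differ as well.\<close>
    have "\<omega> k \<noteq> real m * \<omega> 1"
    proof (cases "k = 1")
      case True
      then show ?thesis using km(3) \<omega>[OF I(2)] by (auto simp: N_def)
    next
      case False
      then have "Z_independent (\<omega> k) (\<omega> 1)" using assms(6) km(2) by (simp add: I_def)
      then have "of_int 1 * \<omega> k + of_int (- int m) * \<omega> 1 = 0 \<longrightarrow> (1::int) = 0 \<and> - int m = 0"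
        unfolding Z_independent_def by blast
      then show ?thesis by simp
    qed
    then show "(case x of (k, m) \<Rightarrow> (\<omega> k)\<^sup>2 - (real m * \<omega> 1)\<^sup>2) \<noteq> 0"
      using \<omega>[OF km(2)] \<omega>[OF I(2)] by (simp add: km(1) power2_eq_iff_nonneg)
  qed
  obtain \<eta> where \<eta>: "\<eta> > 0"
    and gap: "\<forall>\<^sub>F \<epsilon> in at_right 0. \<forall>k\<in>I. \<forall>m\<in>N k. \<eta> \<le> \<bar>(\<omega> k)\<^sup>2 - (real m * \<nu> \<epsilon>)\<^sup>2\<bar>"
    using away unfolding split_paired_Ball_Sigma prod.case by blast

  \<comment> \<open>Choice of the radius and of the time scale\<close>
  define A where "A = (\<Sum>k\<in>I. \<bar>D k\<bar> * (\<bar>amp k\<bar> + C0))"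
  \<comment> \<open>For \<epsilon> at most 1, \<open>A\<close> bounds the initial coupling scalar,
    and the surplus 1 is the room left for its growth.\<close>
  define R where "R = A + 1"
  define L where "L = 2 * \<bar>c\<bar> * R + 3 * \<bar>d\<bar> * R\<^sup>2"
  have "0 \<le> A" unfolding A_def using \<open>0 \<le> C0\<close> by (intro sum_nonneg) simp
  then have "0 \<le> R" "0 \<le> L" by (simp_all add: R_def L_def)
  \<comment> \<open>The factor \<open>R + 1\<close> dominates both 1 and \<open>R\<close>, so one
    choice serves the contraction and the absorption of feedback through \<open>L * W\<close>, and
    the confinement to the radius through \<open>L * W * R\<close>. The added 1 keeps the
    denominator positive when \<open>L * W = 0\<close>.\<close>
  define \<gamma> where "\<gamma> = 1 / (2 * (L * W * (R + 1) + 1))"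
  have "0 \<le> L * W * (R + 1)" "L * W \<le> L * W * (R + 1)" "L * W * R \<le> L * W * (R + 1)"
    using \<open>0 \<le> L\<close> \<open>0 \<le> W\<close> \<open>0 \<le> R\<close> by (simp_all add: distrib_left)
  then have \<gamma>: "0 < \<gamma>" "\<gamma> * (L * W) \<le> 1 / 2" "\<gamma> * (L * W * R) \<le> 1 / 2"
    by (simp_all add: \<gamma>_def divide_simps)
  have lip: "\<bar>force c d x - force c d y\<bar> \<le> L * \<bar>x - y\<bar>" if "\<bar>x\<bar> \<le> R" "\<bar>y\<bar> \<le> R" for x y
    unfolding L_def using that by (rule force_lipschitz)
  have fbound: "\<bar>force c d x\<bar> \<le> L * R" if "\<bar>x\<bar> \<le> R" for x
  proof -
    have "\<bar>force c d x\<bar> \<le> L * \<bar>x\<bar>"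
      using lip[OF that, of 0] \<open>0 \<le> R\<close> by (simp add: force_def)
    also have "\<dots> \<le> L * R" using that \<open>0 \<le> L\<close> by (rule mult_left_mono)
    finally show ?thesis .
  qed
  have aR: "\<bar>D 1 * a10\<bar> \<le> R"
  proof -
    have "\<bar>D 1\<bar> * (\<bar>amp 1\<bar> + C0) \<le> A"
      unfolding A_def using I \<open>0 \<le> C0\<close> by (intro member_le_sum) auto
    moreover have "\<bar>D 1 * a10\<bar> \<le> \<bar>D 1\<bar> * (\<bar>amp 1\<bar> + C0)"
      using \<open>0 \<le> C0\<close> by (simp add: abs_mult amp_def mult_left_mono)
    ultimately show ?thesis by (simp add: R_def)
  qed
  have small: "\<gamma> * L * (\<Sum>k\<in>I. (D k)\<^sup>2 / \<omega> k) \<le> 1 / 2"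
    using \<gamma>(2) by (simp add: W_def mult.assoc)
  from weakly_nonlinear_estimate[OF I \<omega> \<eta> \<open>0 \<le> L\<close> \<gamma>(1) lip aR small, of C0, folded \<nu> N_def amp_def]
  obtain C where C: "\<And>\<epsilon> z z' k t. 0 < \<epsilon> \<Longrightarrow> \<epsilon> \<le> 1 \<Longrightarrow>
      coupled_modes I \<omega> D (\<lambda>x. \<epsilon> * force c d x) (\<gamma> / \<epsilon>) z z' \<Longrightarrow>
      \<forall>t\<in>{0..\<gamma> / \<epsilon>}. \<bar>\<Sum>i\<in>I. D i * z i t\<bar> \<le> R \<Longrightarrow>
      \<forall>k\<in>I. \<forall>m\<in>N k. \<eta> \<le> \<bar>(\<omega> k)\<^sup>2 - (real m * \<nu> \<epsilon>)\<^sup>2\<bar> \<Longrightarrow>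
      \<forall>k\<in>I. \<bar>z k 0 - amp k\<bar> \<le> C0 * \<epsilon> \<Longrightarrow> k \<in> I \<Longrightarrow> t \<in> {0..\<gamma> / \<epsilon>} \<Longrightarrow>
        \<bar>z k t - amp k * cos (\<nu> \<epsilon> * t)\<bar> \<le> C * \<epsilon> \<and>
        \<bar>z' k t + amp k * \<nu> \<epsilon> * sin (\<nu> \<epsilon> * t)\<bar> \<le> C * \<epsilon> \<and>
        \<bar>- D k * (\<epsilon> * force c d (\<Sum>i\<in>I. D i * z i t)) - (\<omega> k)\<^sup>2 * z k t
          + amp k * (\<nu> \<epsilon>)\<^sup>2 * cos (\<nu> \<epsilon> * t)\<bar> \<le> C * \<epsilon>"
    by blast
  \<comment> \<open>Stated for a general \<open>F\<close> because it serves the truncated force in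
    the existence proof and the polynomial force of a given solution. The scalar is at most
    \<open>A + 1 / 2\<close>, which is below \<open>R\<close>.\<close>
  have bounded: "\<bar>\<Sum>i\<in>I. D i * z i t\<bar> \<le> R"
    if \<epsilon>: "0 < \<epsilon>" "\<epsilon> \<le> 1" and z: "coupled_modes I \<omega> D (\<lambda>x. \<epsilon> * F x) (\<gamma> / \<epsilon>) z z'"
      and F: "\<And>x. \<bar>x\<bar> \<le> R \<Longrightarrow> \<bar>F x\<bar> \<le> L * R"
      and z0: "\<forall>k\<in>I. \<bar>z k 0 - amp k\<bar> \<le> C0 * \<epsilon>" and t: "t \<in> {0..\<gamma> / \<epsilon>}" for \<epsilon> F z z' t
  proof (rule coupled_modes_bounded[OF \<omega> _ z _ _ t])
    show "0 \<le> \<epsilon> * (L * R)" using \<epsilon> \<open>0 \<le> L\<close> \<open>0 \<le> R\<close> by simp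
    show "\<bar>\<epsilon> * F x\<bar> \<le> \<epsilon> * (L * R)" if "\<bar>x\<bar> \<le> R" for x
      using F[OF that] \<epsilon> by (simp add: abs_mult)
    have "C0 * \<epsilon> \<le> C0" using \<epsilon> \<open>0 \<le> C0\<close> by (simp add: mult_left_le)
    then have "(\<Sum>k\<in>I. \<bar>D k\<bar> * \<bar>z k 0\<bar>) \<le> A"
      unfolding A_def using z0 by (intro sum_mono mult_left_mono) fastforce+
    moreover have "\<gamma> / \<epsilon> * (\<epsilon> * (L * R)) * W = \<gamma> * (L * W * R)"
      using \<epsilon> by simp
    ultimately show "(\<Sum>k\<in>I. \<bar>D k\<bar> * \<bar>z k 0\<bar>)
        + \<gamma> / \<epsilon> * (\<epsilon> * (L * R)) * (\<Sum>k\<in>I. (D k)\<^sup>2 / \<omega> k) < R"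
      using \<gamma>(3) unfolding W_def[symmetric] R_def by linarith
  qed

  \<comment> \<open>Existence and expansion for small \<epsilon>\<close>
  have "\<forall>\<^sub>F \<epsilon> in at_right (0::real). \<epsilon> \<le> 1"
    by (rule eventually_at_rightI[of 0 1]) auto
  with eventually_at_right_less[of 0] init gap
  have "\<forall>\<^sub>F \<epsilon> in at_right 0.
      (\<exists>y. modal_solution n p c d \<omega> \<phi> \<epsilon> (\<lambda>k. y0 k \<epsilon>) (\<gamma> / \<epsilon>) y) \<and>
      (\<forall>y. modal_solution n p c d \<omega> \<phi> \<epsilon> (\<lambda>k. y0 k \<epsilon>) (\<gamma> / \<epsilon>) y \<longrightarrow>
        (\<exists>r. (\<forall>t\<in>{0..\<gamma> / \<epsilon>}.
                y 1 t = \<epsilon> * a10 * cos (\<nu> \<epsilon> * t) + \<epsilon>\<^sup>2 * r 1 t \<and>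
                (\<forall>k\<in>{1..n}. k \<noteq> 1 \<longrightarrow> y k t = \<epsilon>\<^sup>2 * r k t)) \<and>
             (\<forall>k\<in>{1..n}. C2_bounded_by C (\<gamma> / \<epsilon>) (r k))))"
  proof eventually_elim
    case (elim \<epsilon>)
    note \<epsilon> = elim(1,4)
    have "\<exists>y. modal_solution n p c d \<omega> \<phi> \<epsilon> (\<lambda>k. y0 k \<epsilon>) (\<gamma> / \<epsilon>) y"
    proof -
      \<comment> \<open>truncated so as to be globally Lipschitz; the solution never leaves the unmodified range\<close>
      define F where "F x = force c d (max (- R) (min R x))" for x
      have F: "F x = force c d x" if "\<bar>x\<bar> \<le> R" for x
      proof -
        have "- R \<le> x" "x \<le> R" using that by auto
        then show ?thesis by (simp add: F_def max_absorb2 min_absorb2)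
      qed
      \<comment> \<open>Clipping to \<open>[-R, R]\<close> does not increase distances, so
        \<open>F\<close> inherits on the whole line the constant \<open>L\<close> that the force has
        on this interval.\<close>
      have lipF: "\<bar>\<epsilon> * F x - \<epsilon> * F y\<bar> \<le> \<epsilon> * L * \<bar>x - y\<bar>" for x y
      proof -
        have "\<bar>F x - F y\<bar> \<le> L * \<bar>max (- R) (min R x) - max (- R) (min R y)\<bar>"
          unfolding F_def using \<open>0 \<le> R\<close> by (intro lip) auto
        also have "\<dots> \<le> L * \<bar>x - y\<bar>"
          using \<open>0 \<le> L\<close> by (intro mult_left_mono) auto
        finally have "\<epsilon> * \<bar>F x - F y\<bar> \<le> \<epsilon> * (L * \<bar>x - y\<bar>)"
          using \<epsilon> by (intro mult_left_mono) auto
        then show ?thesis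
          using \<epsilon> by (simp add: abs_mult mult.assoc flip: right_diff_distrib)
      qed
      have "\<exists>z z'. coupled_modes I \<omega> D (\<lambda>x. \<epsilon> * F x) (\<gamma> / \<epsilon>) z z' \<and> (\<forall>k\<in>I. z k 0 = y0 k \<epsilon> / \<epsilon>)"
      proof (rule coupled_modes_exist[where L = "\<epsilon> * L"])
        show "\<gamma> / \<epsilon> * (\<epsilon> * L) * (\<Sum>k\<in>I. (D k)\<^sup>2 / \<omega> k) < 1"
          using \<gamma>(2) \<epsilon> by (simp add: W_def mult.assoc)
      qed (use \<omega> lipF \<gamma>(1) \<epsilon> \<open>0 \<le> L\<close> in auto)
      then obtain z z' where z: "coupled_modes I \<omega> D (\<lambda>x. \<epsilon> * F x) (\<gamma> / \<epsilon>) z z'"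
        and z0: "\<forall>k\<in>I. z k 0 = y0 k \<epsilon> / \<epsilon>"
        by blast
      have "\<bar>\<Sum>i\<in>I. D i * z i t\<bar> \<le> R" if "t \<in> {0..\<gamma> / \<epsilon>}" for t
      proof (rule bounded[OF \<epsilon> z _ _ that])
        show "\<bar>F x\<bar> \<le> L * R" if "\<bar>x\<bar> \<le> R" for x
          unfolding F[OF that] using that by (rule fbound)
        show "\<forall>k\<in>I. \<bar>z k 0 - amp k\<bar> \<le> C0 * \<epsilon>"
          using elim(2) z0 by simp
      qed
      note FS = F[OF this]
      have "coupled_modes I \<omega> D (\<lambda>x. \<epsilon> * force c d x) (\<gamma> / \<epsilon>) z z'"
        unfolding coupled_modes_def
      proof (intro ballI conjI)
        fix k assume k: "k \<in> I"
        show "z' k 0 = 0"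
          using z k by (rule coupled_modesD)
        fix t assume t: "t \<in> {0..\<gamma> / \<epsilon>}"
        show "(z k has_real_derivative z' k t) (at t within {0..\<gamma> / \<epsilon>})"
          using z k t by (rule coupled_modesD)
        show "(z' k has_real_derivative - D k * (\<epsilon> * force c d (\<Sum>i\<in>I. D i * z i t))
            - (\<omega> k)\<^sup>2 * z k t) (at t within {0..\<gamma> / \<epsilon>})"
          using coupled_modesD(3)[OF z k t] unfolding FS[OF t] .
      qed
      then show ?thesis
        using modal_solution_of_coupled_modes[OF \<epsilon>(1), of n \<omega> p \<phi> c d "\<gamma> / \<epsilon>" z z' "\<lambda>k. y0 k \<epsilon>"] z0
        unfolding I_def D_def by blast
    qed
    moreover have "\<exists>r. (\<forall>t\<in>{0..\<gamma> / \<epsilon>}.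
          y 1 t = \<epsilon> * a10 * cos (\<nu> \<epsilon> * t) + \<epsilon>\<^sup>2 * r 1 t \<and>
          (\<forall>k\<in>{1..n}. k \<noteq> 1 \<longrightarrow> y k t = \<epsilon>\<^sup>2 * r k t)) \<and>
        (\<forall>k\<in>{1..n}. C2_bounded_by C (\<gamma> / \<epsilon>) (r k))"
      if y: "modal_solution n p c d \<omega> \<phi> \<epsilon> (\<lambda>k. y0 k \<epsilon>) (\<gamma> / \<epsilon>) y" for y
    proof -
      define z where "z k t = y k t / \<epsilon>" for k t
      obtain z' where z: "coupled_modes I \<omega> D (\<lambda>x. \<epsilon> * force c d x) (\<gamma> / \<epsilon>) z z'"
        and y0: "\<And>k. k \<in> I \<Longrightarrow> y k 0 = y0 k \<epsilon>"
        using coupled_modes_of_modal_solution[OF \<epsilon>(1) y] unfolding I_def D_def z_def by blast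
      have z0: "\<forall>k\<in>I. \<bar>z k 0 - amp k\<bar> \<le> C0 * \<epsilon>"
        using elim(2) by (simp add: z_def y0)
      have zR: "\<forall>t\<in>{0..\<gamma> / \<epsilon>}. \<bar>\<Sum>i\<in>I. D i * z i t\<bar> \<le> R"
        using bounded[OF \<epsilon> z fbound z0] by blast
      \<comment> \<open>The error of \<open>z\<close> is \<open>\<epsilon> * r\<close>, so the error
        of \<open>y = \<epsilon> z\<close> is \<open>\<epsilon>\<^sup>2 * r\<close>. For
        \<open>k\<close> other than 1 the amplitude is 0 and only this term remains.\<close>
      define r where "r k t = (z k t - amp k * cos (\<nu> \<epsilon> * t)) / \<epsilon>" for k t
      have "C2_bounded_by C (\<gamma> / \<epsilon>) (r k)" if k: "k \<in> I" for k
        unfolding r_def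
        using z k \<epsilon>(1) C[OF \<epsilon> z zR elim(3) z0 k] by (rule coupled_modes_imp_C2_bounded)
      moreover have "y k t = \<epsilon> * amp k * cos (\<nu> \<epsilon> * t) + \<epsilon>\<^sup>2 * r k t" for k t
        using \<epsilon>(1) by (simp add: r_def z_def field_simps power2_eq_square)
      ultimately show ?thesis
        by (intro exI[of _ r]) (auto simp: I_def amp_def)
    qed
    ultimately show ?case by blast
  qed
  then show ?thesis using \<gamma>(1) by blast
qed

end
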